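(* Let $\mathcal{D}$ be a triangulated category with shift functor $[1]$, let $(\mathcal{U}^{\leqslant 0},\mathcal{U}^{\geqslant 0})$ be a $t$-structure on $\mathcal{D}$ with heart $\mathcal{H}$, and let $m$ be a positive integer. Let $\mathcal{S}$ be a triangulated full subcategory of $\mathcal{D}$ such that $(\mathcal{S}\cap\mathcal{U}^{\leqslant 0},\mathcal{S}\cap\mathcal{U}^{\geqslant 0})$ is a $t$-structure on $\mathcal{S}$ and $\mathcal{H}\subseteq\mathcal{S}$. Then there are order preserving, mutually inverse bijections $\lambda$ (from (1) to (2)) and $\mu$ (from (2) to (1)) between (1) the poset of $t$-structures $(\mathcal{X}^{\leqslant 0},\mathcal{X}^{\geqslant 0})$ on $\mathcal{D}$ with $\mathcal{U}^{\leqslant -m}\subseteq\mathcal{X}^{\leqslant 0}\subseteq\mathcal{U}^{\leqslant 0}$, and (2) the poset of $t$-structures $(\mathcal{Y}^{\leqslant 0},\mathcal{Y}^{\geqslant 0})$ on $\mathcal{S}$ with $\mathcal{S}\cap\mathcal{U}^{\leqslant -m}\subseteq\mathcal{Y}^{\leqslant 0}\subseteq\mathcal{S}\cap\mathcal{U}^{\leqslant 0}$, given by $$\lambda(\mathcal{X}^{\leqslant 0},\mathcal{X}^{\geqslant 0})=(\mathcal{S}\cap\mathcal{X}^{\leqslant 0},\ \mathcal{S}\cap\mathcal{X}^{\geqslant 0}),\qquad \mu(\mathcal{Y}^{\leqslant 0},\mathcal{Y}^{\geqslant 0})=(\mathcal{U}^{\leqslant -m}*\mathcal{Y}^{\leqslant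 0},\ \mathcal{Y}^{\geqslant 0}*\mathcal{U}^{\geqslant 0}).$$
   Context: All categories are skeletally small; all subcategories are full and closed under isomorphisms. For subcategories $\mathcal{X},\mathcal{Y}$ of $\mathcal{D}$, $\mathcal{X}*\mathcal{Y}$ is the subcategory of objects $A$ of $\mathcal{D}$ admitting a distinguished triangle $X\to A\to Y\to X[1]$ with $X\in\mathcal{X}$, $Y\in\mathcal{Y}$. A $t$-structure on a triangulated category $\mathcal{D}$ is a pair $(\mathcal{U}^{\leqslant 0},\mathcal{U}^{\geqslant 0})$ of subcategories such that, writing $\mathcal{U}^{\leqslant n}=\mathcal{U}^{\leqslant 0}[-n]$, $\mathcal{U}^{\geqslant n}=\mathcal{U}^{\geqslant 0}[-n]$: $\mathcal{D}(\mathcal{U}^{\leqslant 0},\mathcal{U}^{\geqslant 1})=0$, $\mathcal{D}=\mathcal{U}^{\leqslant 0}*\mathcal{U}^{\geqslant 1}$, $\mathcal{U}^{\leqslant 0}\subseteq\mathcal{U}^{\leqslant 1}$, $\mathcal{U}^{\geqslant 1}\subseteq\mathcal{U}^{\geqslant 0}$. Its heart is $\mathcal{H}=\mathcal{U}^{\leqslant 0}\cap\mathcal{U}^{\geqslant 0}$. $t$-structures are ordered by inclusion of the aisles (the first components). *)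

theory Defs
  imports "HOL-Algebra.Group"
begin

section \<open>Additive categories\<close>

record ('o, 'm) cat =
  obj :: "'o set"
  arr :: "'m set"
  src :: "'m \<Rightarrow> 'o"
  tgt :: "'m \<Rightarrow> 'o"
  idn :: "'o \<Rightarrow> 'm"
  cmp :: "'m \<Rightarrow> 'm \<Rightarrow> 'm" (infixl "\<cdot>\<index>" 70)

definition homset :: "('o, 'm, 'a) cat_scheme \<Rightarrow> 'o \<Rightarrow> 'o \<Rightarrow> 'm set" where
  "homset C X Y = {f \<in> arr C. src C f = X \<and> tgt C f = Y}"

text \<open>Composition is written in applicative order: \<open>g \<cdot> f\<close> is first \<open>f\<close>, then \<open>g\<close>.\<close>

locale category =
  fixes C :: "('o, 'm, 'a) cat_scheme" (structure)
  assumes src_obj: "f \<in> arr C \<Longrightarrow> src C f \<in> obj C"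
    and tgt_obj: "f \<in> arr C \<Longrightarrow> tgt C f \<in> obj C"
    and idn_hom: "X \<in> obj C \<Longrightarrow> idn C X \<in> homset C X X"
    and cmp_hom: "\<lbrakk>f \<in> homset C X Y; g \<in> homset C Y Z\<rbrakk> \<Longrightarrow> g \<cdot> f \<in> homset C X Z"
    and cmp_assoc: "\<lbrakk>f \<in> homset C W X; g \<in> homset C X Y; h \<in> homset C Y Z\<rbrakk>
      \<Longrightarrow> (h \<cdot> g) \<cdot> f = h \<cdot> (g \<cdot> f)"
    and idn_left: "f \<in> homset C X Y \<Longrightarrow> idn C Y \<cdot> f = f"
    and idn_right: "f \<in> homset C X Y \<Longrightarrow> f \<cdot> idn C X = f"

definition iso_arr :: "('o, 'm, 'a) cat_scheme \<Rightarrow> 'm \<Rightarrow> bool" where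
  "iso_arr C f \<longleftrightarrow> f \<in> arr C \<and>
     (\<exists>g \<in> homset C (tgt C f) (src C f).
        g \<cdot>\<^bsub>C\<^esub> f = idn C (src C f) \<and> f \<cdot>\<^bsub>C\<^esub> g = idn C (tgt C f))"

definition isomorphic :: "('o, 'm, 'a) cat_scheme \<Rightarrow> 'o \<Rightarrow> 'o \<Rightarrow> bool" where
  "isomorphic C X Y \<longleftrightarrow> (\<exists>f \<in> homset C X Y. iso_arr C f)"

record ('o, 'm) preadd_cat = "('o, 'm) cat" +
  hplus :: "'m \<Rightarrow> 'm \<Rightarrow> 'm" (infixl "\<oplus>\<^sub>h\<index>" 65)
  hzero :: "'o \<Rightarrow> 'o \<Rightarrow> 'm"

text \<open>The group of morphisms \<open>X \<rightarrow> Y\<close>; its HOL-Algebra multiplication is the addition of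
  morphisms, so its \<open>inv\<close> is negation.\<close>

definition hom_group :: "('o, 'm, 'a) preadd_cat_scheme \<Rightarrow> 'o \<Rightarrow> 'o \<Rightarrow> 'm monoid" where
  "hom_group C X Y = \<lparr>carrier = homset C X Y, mult = hplus C, one = hzero C X Y\<rparr>"

definition hneg :: "('o, 'm, 'a) preadd_cat_scheme \<Rightarrow> 'm \<Rightarrow> 'm" where
  "hneg C f = inv\<^bsub>hom_group C (src C f) (tgt C f)\<^esub> f"

definition zero_object :: "('o, 'm, 'a) preadd_cat_scheme \<Rightarrow> 'o \<Rightarrow> bool" where
  "zero_object C Z \<longleftrightarrow> Z \<in> obj C \<and>
     (\<forall>X \<in> obj C. homset C X Z = {hzero C X Z} \<and> homset C Z X = {hzero C Z X})"

definition biproduct ::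
  "('o, 'm, 'a) preadd_cat_scheme \<Rightarrow> 'o \<Rightarrow> 'o \<Rightarrow> 'o \<Rightarrow> 'm \<Rightarrow> 'm \<Rightarrow> 'm \<Rightarrow> 'm \<Rightarrow> bool" where
  "biproduct C X Y P i j p q \<longleftrightarrow>
     i \<in> homset C X P \<and> j \<in> homset C Y P \<and> p \<in> homset C P X \<and> q \<in> homset C P Y \<and>
     p \<cdot>\<^bsub>C\<^esub> i = idn C X \<and> q \<cdot>\<^bsub>C\<^esub> j = idn C Y \<and>
     q \<cdot>\<^bsub>C\<^esub> i = hzero C X Y \<and> p \<cdot>\<^bsub>C\<^esub> j = hzero C Y X \<and>
     (i \<cdot>\<^bsub>C\<^esub> p) \<oplus>\<^sub>h\<^bsub>C\<^esub> (j \<cdot>\<^bsub>C\<^esub> q) = idn C P"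

locale additive_category = category C
  for C :: "('o, 'm, 'a) preadd_cat_scheme" (structure) +
  assumes hom_comm_group:
      "\<lbrakk>X \<in> obj C; Y \<in> obj C\<rbrakk> \<Longrightarrow> comm_group (hom_group C X Y)"
    and cmp_hplus_left: "\<lbrakk>f \<in> homset C X Y; g \<in> homset C Y Z; g' \<in> homset C Y Z\<rbrakk>
      \<Longrightarrow> (g \<oplus>\<^sub>h g') \<cdot> f = (g \<cdot> f) \<oplus>\<^sub>h (g' \<cdot> f)"
    and cmp_hplus_right: "\<lbrakk>f \<in> homset C X Y; f' \<in> homset C X Y; g \<in> homset C Y Z\<rbrakk>
      \<Longrightarrow> g \<cdot> (f \<oplus>\<^sub>h f') = (g \<cdot> f) \<oplus>\<^sub>h (g \<cdot> f')"
    and ex_zero_object: "\<exists>Z. zero_object C Z"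
    and ex_biproduct: "\<lbrakk>X \<in> obj C; Y \<in> obj C\<rbrakk>
      \<Longrightarrow> \<exists>P \<in> obj C. \<exists>i j p q. biproduct C X Y P i j p q"

section \<open>Triangulated categories\<close>

text \<open>A triangle \<open>X \<rightarrow> Y \<rightarrow> Z \<rightarrow> X[1]\<close> is encoded by its three morphisms;
  \<open>sho\<close> and \<open>sha\<close> are the shift functor \<open>[1]\<close> on objects and on morphisms.\<close>

record ('o, 'm) tri_cat = "('o, 'm) preadd_cat" +
  sho :: "'o \<Rightarrow> 'o"
  sha :: "'m \<Rightarrow> 'm"
  dist_tri :: "('m \<times> 'm \<times> 'm) set"

definition triangle :: "('o, 'm, 'a) tri_cat_scheme \<Rightarrow> 'm \<times> 'm \<times> 'm \<Rightarrow> bool" where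
  "triangle D = (\<lambda>(f, g, h). f \<in> arr D \<and> g \<in> arr D \<and> h \<in> arr D \<and>
     tgt D f = src D g \<and> tgt D g = src D h \<and> tgt D h = sho D (src D f))"

definition triangle_map ::
  "('o, 'm, 'a) tri_cat_scheme \<Rightarrow> 'm \<times> 'm \<times> 'm \<Rightarrow> 'm \<times> 'm \<times> 'm \<Rightarrow> 'm \<times> 'm \<times> 'm \<Rightarrow> bool" where
  "triangle_map D = (\<lambda>(f, g, h) (f', g', h') (u, v, w).
     u \<in> homset D (src D f) (src D f') \<and>
     v \<in> homset D (src D g) (src D g') \<and>
     w \<in> homset D (src D h) (src D h') \<and>
     v \<cdot>\<^bsub>D\<^esub> f = f' \<cdot>\<^bsub>D\<^esub> u \<and>
     w \<cdot>\<^bsub>D\<^esub> g = g' \<cdot>\<^bsub>D\<^esub> v \<and>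
     sha D u \<cdot>\<^bsub>D\<^esub> h = h' \<cdot>\<^bsub>D\<^esub> w)"

text \<open>The shift is an additive autoequivalence, not necessarily a strict automorphism.\<close>

locale triangulated_category = additive_category D
  for D :: "('o, 'm, 'a) tri_cat_scheme" (structure) +
  assumes sho_obj: "X \<in> obj D \<Longrightarrow> sho D X \<in> obj D"
    and sha_idn: "X \<in> obj D \<Longrightarrow> sha D (idn D X) = idn D (sho D X)"
    and sha_cmp: "\<lbrakk>f \<in> homset D X Y; g \<in> homset D Y Z\<rbrakk>
      \<Longrightarrow> sha D (g \<cdot> f) = sha D g \<cdot> sha D f"
    and sha_hplus: "\<lbrakk>f \<in> homset D X Y; g \<in> homset D X Y\<rbrakk>
      \<Longrightarrow> sha D (f \<oplus>\<^sub>h g) = sha D f \<oplus>\<^sub>h sha D g"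
    and sha_fully_faithful: "\<lbrakk>X \<in> obj D; Y \<in> obj D\<rbrakk>
      \<Longrightarrow> bij_betw (sha D) (homset D X Y) (homset D (sho D X) (sho D Y))"
    and sho_ess_surj: "Y \<in> obj D \<Longrightarrow> \<exists>X \<in> obj D. isomorphic D (sho D X) Y"
    and dist_triangle: "t \<in> dist_tri D \<Longrightarrow> triangle D t"
    and dist_iso: "\<lbrakk>t \<in> dist_tri D; triangle D t'; triangle_map D t t' (u, v, w);
        iso_arr D u; iso_arr D v; iso_arr D w\<rbrakk> \<Longrightarrow> t' \<in> dist_tri D"
    and dist_idn: "\<lbrakk>X \<in> obj D; zero_object D Z\<rbrakk>
      \<Longrightarrow> (idn D X, hzero D X Z, hzero D Z (sho D X)) \<in> dist_tri D"
    and dist_ex: "f \<in> arr D \<Longrightarrow> \<exists>g h. (f, g, h) \<in> dist_tri D"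
    and dist_rotate: "triangle D (f, g, h)
      \<Longrightarrow> (f, g, h) \<in> dist_tri D \<longleftrightarrow> (g, h, hneg D (sha D f)) \<in> dist_tri D"
    and dist_map: "\<lbrakk>(f, g, h) \<in> dist_tri D; (f', g', h') \<in> dist_tri D;
        u \<in> homset D (src D f) (src D f'); v \<in> homset D (tgt D f) (tgt D f');
        v \<cdot> f = f' \<cdot> u\<rbrakk> \<Longrightarrow> \<exists>w. triangle_map D (f, g, h) (f', g', h') (u, v, w)"
    and octahedral: "\<lbrakk>tgt D f = src D g; (f, h, k) \<in> dist_tri D; (g, l, m) \<in> dist_tri D;
        (g \<cdot> f, n, p) \<in> dist_tri D\<rbrakk>
      \<Longrightarrow> \<exists>u v. (u, v, sha D h \<cdot> m) \<in> dist_tri D \<and>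
            triangle_map D (f, h, k) (g \<cdot> f, n, p) (idn D (src D f), g, u) \<and>
            triangle_map D (g \<cdot> f, n, p) (g, l, m) (f, idn D (tgt D g), v)"

section \<open>Subcategories and t-structures\<close>

text \<open>Full subcategories closed under isomorphisms are represented by their sets of objects.\<close>

definition subcat :: "('o, 'm, 'a) cat_scheme \<Rightarrow> 'o set \<Rightarrow> bool" where
  "subcat C \<X> \<longleftrightarrow> \<X> \<subseteq> obj C \<and> (\<forall>X \<in> \<X>. \<forall>A \<in> obj C. isomorphic C X A \<longrightarrow> A \<in> \<X>)"

definition full_subcat ::
  "('o, 'm, 'a) tri_cat_scheme \<Rightarrow> 'o set \<Rightarrow> ('o, 'm, 'a) tri_cat_scheme" where
  "full_subcat D \<S> = D\<lparr>obj := \<S>,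
     arr := {f \<in> arr D. src D f \<in> \<S> \<and> tgt D f \<in> \<S>},
     dist_tri := {(f, g, h) \<in> dist_tri D. src D f \<in> \<S> \<and> src D g \<in> \<S> \<and> src D h \<in> \<S>}\<rparr>"

definition triangulated_subcat :: "('o, 'm, 'a) tri_cat_scheme \<Rightarrow> 'o set \<Rightarrow> bool" where
  "triangulated_subcat D \<S> \<longleftrightarrow> subcat D \<S> \<and>
     (\<exists>Z \<in> \<S>. zero_object D Z) \<and>
     (\<forall>X \<in> obj D. X \<in> \<S> \<longleftrightarrow> sho D X \<in> \<S>) \<and>
     (\<forall>f g h. (f, g, h) \<in> dist_tri D \<longrightarrow> src D f \<in> \<S> \<longrightarrow> tgt D f \<in> \<S> \<longrightarrow> tgt D g \<in> \<S>)"

text \<open>\<open>shifted D \<X> n\<close> is the closure of \<open>\<X>[n]\<close> under isomorphisms. An inverse of the shift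
  functor is not part of the data, so negative powers are moved to the other side:
  \<open>A \<cong> X[n]\<close> is expressed as \<open>A[-n] \<cong> X\<close> when \<open>n < 0\<close>.\<close>

definition shifted :: "('o, 'm, 'a) tri_cat_scheme \<Rightarrow> 'o set \<Rightarrow> int \<Rightarrow> 'o set" where
  "shifted D \<X> n = {A \<in> obj D. \<exists>X \<in> \<X>.
     isomorphic D ((sho D ^^ nat (- n)) A) ((sho D ^^ nat n) X)}"

text \<open>With \<open>\<X> = \<U>\<^sup>\<le>\<^sup>0\<close> this is \<open>\<U>\<^sup>\<le>\<^sup>n\<close>, and with \<open>\<X> = \<U>\<^sup>\<ge>\<^sup>0\<close> it is \<open>\<U>\<^sup>\<ge>\<^sup>n\<close>.\<close>

definition level :: "('o, 'm, 'a) tri_cat_scheme \<Rightarrow> 'o set \<Rightarrow> int \<Rightarrow> 'o set" where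
  "level D \<X> n = shifted D \<X> (- n)"

definition star :: "('o, 'm, 'a) tri_cat_scheme \<Rightarrow> 'o set \<Rightarrow> 'o set \<Rightarrow> 'o set" where
  "star D \<X> \<Y> = {A \<in> obj D. \<exists>X \<in> \<X>. \<exists>Y \<in> \<Y>. \<exists>f g h. (f, g, h) \<in> dist_tri D \<and>
     f \<in> homset D X A \<and> g \<in> homset D A Y \<and> h \<in> homset D Y (sho D X)}"

definition t_structure :: "('o, 'm, 'a) tri_cat_scheme \<Rightarrow> 'o set \<times> 'o set \<Rightarrow> bool" where
  "t_structure D = (\<lambda>(\<U>, \<V>). subcat D \<U> \<and> subcat D \<V> \<and>
     (\<forall>X \<in> \<U>. \<forall>Y \<in> level D \<V> 1. homset D X Y = {hzero D X Y}) \<and>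
     obj D = star D \<U> (level D \<V> 1) \<and>
     \<U> \<subseteq> level D \<U> 1 \<and>
     level D \<V> 1 \<subseteq> \<V>)"

definition heart :: "'o set \<times> 'o set \<Rightarrow> 'o set" where
  "heart T = fst T \<inter> snd T"

definition t_le :: "'o set \<times> 'o set \<Rightarrow> 'o set \<times> 'o set \<Rightarrow> bool" where
  "t_le T T' \<longleftrightarrow> fst T \<subseteq> fst T'"

definition t_interval ::
  "('o, 'm, 'a) tri_cat_scheme \<Rightarrow> 'o set \<Rightarrow> 'o set \<Rightarrow> ('o set \<times> 'o set) set" where
  "t_interval D \<A> \<B> = {T. t_structure D T \<and> \<A> \<subseteq> fst T \<and> fst T \<subseteq> \<B>}"

end

theory Submission
  imports Defs
begin

text \<open>Write \<open>\<W>\<close> for the strict coaisle \<open>\<U>\<^sup>\<ge>\<^sup>1\<close>, so that \<open>\<U>\<close> and \<open>\<W>\<close> are the full orthogonals of each other,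
  \<open>\<V> = \<W>[1]\<close>, and a t-structure is determined by its aisle. Put
  \<open>\<U>\<^sub>m = \<U>[m]\<close> and \<open>\<W>\<^sub>m = \<W>[m]\<close>; these again form a t-structure.

  The theorem rests on the extended heart \<open>\<U> \<inter> \<W>\<^sub>m\<close>. Its objects are iterated extensions of
  \<open>\<H>, \<H>[1], \<dots>, \<H>[m - 1]\<close>, hence belong to \<open>\<S>\<close> (\<open>extended_heart_subset\<close>). Truncating an object of
  \<open>\<U>\<close> therefore gives \<open>\<U> \<subseteq> \<U>\<^sub>m * (\<U> \<inter> \<W>\<^sub>m)\<close> with second factor inside \<open>\<S>\<close>: every aisle
  between \<open>\<U>\<^sub>m\<close> and \<open>\<U>\<close> is generated under extensions by \<open>\<U>\<^sub>m\<close> and its objects in \<open>\<S>\<close>.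

  \<^item> Restriction (\<open>restrict_aisle_pair\<close>). Let \<open>X \<rightarrow> A \<rightarrow> Y\<close> be the truncation of \<open>A \<in> \<S>\<close> for a
    t-structure in the interval, and let \<open>P \<rightarrow> A \<rightarrow> C\<close> be its truncation for \<open>(\<U>\<^sub>m, \<W>\<^sub>m)\<close>, which lies
    in \<open>\<S>\<close>. Then \<open>P \<rightarrow> A\<close> factors through \<open>X\<close>, and the octahedral axiom puts the cone of
    \<open>P \<rightarrow> X\<close> into the extended heart. So \<open>X\<close> is an extension of objects of \<open>\<S>\<close>.
  \<^item> Extension (\<open>extend_aisle_pair\<close>). Let \<open>(\<Y>, \<W>')\<close> be an aisle and a strict coaisle in \<open>\<S>\<close>. Since the
    extended heart lies in \<open>\<S>\<close>, all of \<open>\<D>\<close> is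
    \<open>\<U>\<^sub>m * (\<U> \<inter> \<W>\<^sub>m) * \<W> \<subseteq> \<U>\<^sub>m * \<Y> * \<W>' * \<W>\<close>, and associativity of \<open>*\<close> splits this product in the middle.
  \<^item> Inverses (\<open>restrict_extend\<close>, \<open>extend_restrict\<close>). It suffices to compare aisles:
    \<open>\<S> \<inter> (\<U>\<^sub>m * \<Y>) = \<Y>\<close> because aisles are closed under extensions, and \<open>\<U>\<^sub>m * (\<S> \<inter> \<X>) = \<X>\<close> because
    truncating \<open>X \<in> \<X>\<close> leaves an object of the extended heart that is again in \<open>\<X>\<close>.\<close>

section \<open>Isomorphisms, zero objects and vanishing of morphisms\<close>

context category
begin

lemma hom_obj: "f \<in> homset C X Y \<Longrightarrow> X \<in> obj C \<and> Y \<in> obj C"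
  using src_obj tgt_obj by (auto simp: homset_def)

lemma isomorphic_iff:
  "isomorphic C X Y \<longleftrightarrow>
     (\<exists>f \<in> homset C X Y. \<exists>g \<in> homset C Y X. g \<cdot> f = idn C X \<and> f \<cdot> g = idn C Y)"
  by (auto simp: isomorphic_def iso_arr_def homset_def)

lemma iso_arrI:
  "\<lbrakk>f \<in> homset C X Y; g \<in> homset C Y X; g \<cdot> f = idn C X; f \<cdot> g = idn C Y\<rbrakk> \<Longrightarrow> iso_arr C f"
  by (auto simp: iso_arr_def homset_def)

lemma iso_idn: "X \<in> obj C \<Longrightarrow> iso_arr C (idn C X)"
  using iso_arrI idn_hom idn_left by blast

lemma isomorphic_refl: "X \<in> obj C \<Longrightarrow> isomorphic C X X"
  using isomorphic_iff idn_hom idn_left by blast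

lemma isomorphic_sym: "isomorphic C X Y \<Longrightarrow> isomorphic C Y X"
  unfolding isomorphic_iff by blast

lemma cmp_inverse:
  assumes f: "f \<in> homset C X Y" and g: "g \<in> homset C Y X" and gf: "g \<cdot> f = idn C X"
    and f': "f' \<in> homset C Y Z" and g': "g' \<in> homset C Z Y" and gf': "g' \<cdot> f' = idn C Y"
  shows "(g \<cdot> g') \<cdot> (f' \<cdot> f) = idn C X"
proof -
  have "(g \<cdot> g') \<cdot> (f' \<cdot> f) = g \<cdot> (g' \<cdot> (f' \<cdot> f))"
    using cmp_assoc[OF cmp_hom[OF f f'] g' g] .
  also have "g' \<cdot> (f' \<cdot> f) = f"
    using cmp_assoc[OF f f' g'] gf' idn_left[OF f] by simp
  finally show ?thesis using gf by simp
qed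

lemma isomorphic_trans:
  assumes "isomorphic C X Y" "isomorphic C Y Z"
  shows "isomorphic C X Z"
proof -
  obtain f g where f: "f \<in> homset C X Y" "g \<in> homset C Y X" "g \<cdot> f = idn C X" "f \<cdot> g = idn C Y"
    using assms(1) isomorphic_iff by auto
  obtain f' g' where f': "f' \<in> homset C Y Z" "g' \<in> homset C Z Y" "g' \<cdot> f' = idn C Y"
    "f' \<cdot> g' = idn C Z"
    using assms(2) isomorphic_iff by auto
  show ?thesis
    unfolding isomorphic_iff
    using cmp_hom[OF f(1) f'(1)] cmp_hom[OF f'(2) f(2)]
      cmp_inverse[OF f(1-3) f'(1-3)] cmp_inverse[OF f'(2,1,4) f(2,1,4)] by blast
qed

lemma isomorphic_obj: "isomorphic C X Y \<Longrightarrow> X \<in> obj C \<and> Y \<in> obj C"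
  unfolding isomorphic_iff using hom_obj by blast

lemma subcatD: "\<lbrakk>subcat C \<X>; X \<in> \<X>; isomorphic C X A\<rbrakk> \<Longrightarrow> A \<in> \<X>"
  unfolding subcat_def using isomorphic_obj by blast

lemma left_right_inverse:
  assumes "f \<in> homset C X Y" "g \<in> homset C Y X" "g' \<in> homset C Y X"
    and "g \<cdot> f = idn C X" "f \<cdot> g' = idn C Y"
  shows "isomorphic C X Y"
proof -
  have "g = g'"
    using assms cmp_assoc[OF assms(3) assms(1) assms(2)] idn_left idn_right by metis
  then show ?thesis using assms isomorphic_iff by blast
qed

end

context additive_category
begin

lemma hom_group_simps:
  "carrier (hom_group C X Y) = homset C X Y" "mult (hom_group C X Y) = hplus C"
  "one (hom_group C X Y) = hzero C X Y"
  by (simp_all add: hom_group_def)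

lemma hom_group: "\<lbrakk>X \<in> obj C; Y \<in> obj C\<rbrakk> \<Longrightarrow> group (hom_group C X Y)"
  using hom_comm_group by (rule comm_group.axioms(2))

lemma hom_group_of: "f \<in> homset C X Y \<Longrightarrow> group (hom_group C X Y)"
  using hom_group hom_obj by blast

lemma hzero_hom: "\<lbrakk>X \<in> obj C; Y \<in> obj C\<rbrakk> \<Longrightarrow> hzero C X Y \<in> homset C X Y"
  using monoid.one_closed[OF group.is_monoid[OF hom_group]] by (simp add: hom_group_simps)

lemma hzero_plus: "\<lbrakk>X \<in> obj C; Y \<in> obj C\<rbrakk> \<Longrightarrow> hzero C X Y \<oplus>\<^sub>h hzero C X Y = hzero C X Y"
  using monoid.l_one[OF group.is_monoid[OF hom_group], of X Y "hzero C X Y"] hzero_hom[of X Y]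
  by (simp add: hom_group_simps)

lemma hneg_eq: "f \<in> homset C X Y \<Longrightarrow> hneg C f = inv\<^bsub>hom_group C X Y\<^esub> f"
  by (auto simp: hneg_def homset_def)

lemma hneg_hom: "f \<in> homset C X Y \<Longrightarrow> hneg C f \<in> homset C X Y"
  using group.inv_closed[OF hom_group_of, of f X Y f] by (simp add: hneg_eq hom_group_simps)

text \<open>The only idempotent of a group is its unit; this is how additive maps are seen to preserve zero.\<close>

lemma hplus_idem_zero: "\<lbrakk>f \<in> homset C X Y; f \<oplus>\<^sub>h f = f\<rbrakk> \<Longrightarrow> f = hzero C X Y"
  using group.l_cancel_one[OF hom_group_of, of f X Y f f] by (simp add: hom_group_simps)

lemma hplus_hneg: "f \<in> homset C X Y \<Longrightarrow> hneg C f \<oplus>\<^sub>h f = hzero C X Y"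
  using group.l_inv[OF hom_group_of, of f X Y f] by (simp add: hneg_eq hom_group_simps)

lemma hneg_unique:
  "\<lbrakk>f \<in> homset C X Y; g \<in> homset C X Y; g \<oplus>\<^sub>h f = hzero C X Y\<rbrakk> \<Longrightarrow> g = hneg C f"
  using group.inv_equality[OF hom_group_of, of f X Y g f] by (simp add: hneg_eq hom_group_simps)

lemma hneg_hneg: "f \<in> homset C X Y \<Longrightarrow> hneg C (hneg C f) = f"
  using group.inv_inv[OF hom_group_of, of f X Y f] hneg_eq[OF hneg_hom]
  by (simp add: hneg_eq hom_group_simps)

lemma hneg_hzero: "\<lbrakk>X \<in> obj C; Y \<in> obj C\<rbrakk> \<Longrightarrow> hneg C (hzero C X Y) = hzero C X Y"
  using hneg_unique hzero_plus hzero_hom by metis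

lemma cmp_hzero_right: "\<lbrakk>g \<in> homset C Y Z; X \<in> obj C\<rbrakk> \<Longrightarrow> g \<cdot> hzero C X Y = hzero C X Z"
  using hplus_idem_zero[OF cmp_hom] cmp_hplus_right hzero_plus hzero_hom hom_obj by metis

lemma cmp_hzero_left: "\<lbrakk>f \<in> homset C X Y; Z \<in> obj C\<rbrakk> \<Longrightarrow> hzero C Y Z \<cdot> f = hzero C X Z"
  using hplus_idem_zero[OF cmp_hom] cmp_hplus_left hzero_plus hzero_hom hom_obj by metis

lemma cmp_hneg_right:
  assumes "f \<in> homset C X Y" "g \<in> homset C Y Z"
  shows "g \<cdot> hneg C f = hneg C (g \<cdot> f)"
proof (rule hneg_unique[OF cmp_hom[OF assms] cmp_hom[OF hneg_hom[OF assms(1)] assms(2)]])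
  show "g \<cdot> hneg C f \<oplus>\<^sub>h g \<cdot> f = hzero C X Z"
    using assms cmp_hplus_right hneg_hom hplus_hneg cmp_hzero_right hom_obj by metis
qed

lemma cmp_hneg_left:
  assumes "f \<in> homset C X Y" "g \<in> homset C Y Z"
  shows "hneg C g \<cdot> f = hneg C (g \<cdot> f)"
proof (rule hneg_unique[OF cmp_hom[OF assms] cmp_hom[OF assms(1) hneg_hom[OF assms(2)]]])
  show "hneg C g \<cdot> f \<oplus>\<^sub>h g \<cdot> f = hzero C X Z"
    using assms cmp_hplus_left hneg_hom hplus_hneg cmp_hzero_left hom_obj by metis
qed

lemma hneg_inj:
  "\<lbrakk>f \<in> homset C X Y; g \<in> homset C X Y; hneg C f = hneg C g\<rbrakk> \<Longrightarrow> f = g"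
  using hneg_hneg by metis

text \<open>Only an inclusion is demanded, so that vanishing of all morphisms can be used and proved without
  knowing that the hom-set contains the zero morphism.\<close>

definition orth :: "'o \<Rightarrow> 'o \<Rightarrow> bool" where
  "orth X Y \<longleftrightarrow> homset C X Y \<subseteq> {hzero C X Y}"

lemma zero_objectI:
  assumes "Z \<in> obj C" "idn C Z = hzero C Z Z"
  shows "zero_object C Z"
proof -
  have "f = hzero C X Z" if "f \<in> homset C X Z" for f X
    using that assms idn_left cmp_hzero_left hom_obj by metis
  moreover have "f = hzero C Z X" if "f \<in> homset C Z X" for f X
    using that assms idn_right cmp_hzero_right hom_obj by metis
  ultimately show ?thesis
    using assms(1) hzero_hom by (fastforce simp: zero_object_def)
qed

lemma zero_objectD:
  assumes "zero_object C Z"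
  shows "Z \<in> obj C" "X \<in> obj C \<Longrightarrow> orth X Z" "X \<in> obj C \<Longrightarrow> orth Z X" "idn C Z = hzero C Z Z"
  using assms idn_hom[of Z] by (auto simp: zero_object_def orth_def)

lemma orthD: "\<lbrakk>orth X Y; f \<in> homset C X Y\<rbrakk> \<Longrightarrow> f = hzero C X Y"
  by (auto simp: orth_def)

lemma orth_self_zero: "\<lbrakk>X \<in> obj C; orth X X\<rbrakk> \<Longrightarrow> zero_object C X"
  using zero_objectI orthD idn_hom by blast

lemma zero_isomorphic: "\<lbrakk>zero_object C X; zero_object C Y\<rbrakk> \<Longrightarrow> isomorphic C X Y"
  unfolding isomorphic_iff zero_object_def using idn_hom cmp_hom by (metis singletonD singletonI)

lemma orth_iso_right:
  assumes "orth X Y" "isomorphic C Y Y'"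
  shows "orth X Y'"
proof -
  obtain f g where f: "f \<in> homset C Y Y'" "g \<in> homset C Y' Y" "f \<cdot> g = idn C Y'"
    using assms(2) isomorphic_iff by auto
  have "a = hzero C X Y'" if a: "a \<in> homset C X Y'" for a
  proof -
    have "a = f \<cdot> (g \<cdot> a)"
      using cmp_assoc[OF a f(2) f(1)] f idn_left[OF a] by simp
    also have "\<dots> = f \<cdot> hzero C X Y"
      using orthD[OF assms(1)] cmp_hom[OF a f(2)] by simp
    finally show ?thesis using cmp_hzero_right f hom_obj a by metis
  qed
  then show ?thesis by (auto simp: orth_def)
qed

lemma orth_iso_left:
  assumes "orth X Y" "isomorphic C X X'"
  shows "orth X' Y"
proof -
  obtain f g where f: "f \<in> homset C X X'" "g \<in> homset C X' X" "f \<cdot> g = idn C X'"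
    using assms(2) isomorphic_iff by auto
  have "a = hzero C X' Y" if a: "a \<in> homset C X' Y" for a
  proof -
    have "a = (a \<cdot> f) \<cdot> g"
      using cmp_assoc[OF f(2) f(1) a] f idn_right[OF a] by simp
    also have "\<dots> = hzero C X Y \<cdot> g"
      using orthD[OF assms(1)] cmp_hom[OF f(1) a] by simp
    finally show ?thesis using cmp_hzero_left f hom_obj a by metis
  qed
  then show ?thesis by (auto simp: orth_def)
qed

end

section \<open>The shift functor\<close>

context triangulated_category
begin

lemma sha_hom: "f \<in> homset D X Y \<Longrightarrow> sha D f \<in> homset D (sho D X) (sho D Y)"
  using sha_fully_faithful[of X Y] hom_obj bij_betwE by blast

lemma sha_full:
  assumes "f \<in> homset D (sho D X) (sho D Y)" "X \<in> obj D" "Y \<in> obj D"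
  obtains f0 where "f0 \<in> homset D X Y" "sha D f0 = f"
  using sha_fully_faithful[of X Y] assms by (force simp: bij_betw_def)

lemma sha_faithful:
  "\<lbrakk>f \<in> homset D X Y; g \<in> homset D X Y; sha D f = sha D g\<rbrakk> \<Longrightarrow> f = g"
  using sha_fully_faithful[of X Y] hom_obj by (metis bij_betw_def inj_onD)

lemma sha_hzero: "\<lbrakk>X \<in> obj D; Y \<in> obj D\<rbrakk> \<Longrightarrow> sha D (hzero D X Y) = hzero D (sho D X) (sho D Y)"
  using hplus_idem_zero sha_hom sha_hplus hzero_hom hzero_plus by metis

lemma sha_hneg:
  assumes f: "f \<in> homset D X Y"
  shows "sha D (hneg D f) = hneg D (sha D f)"
  using hneg_unique[OF sha_hom[OF f] sha_hom[OF hneg_hom[OF f]]]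
    sha_hplus[OF hneg_hom[OF f] f] hplus_hneg[OF f] sha_hzero hom_obj[OF f] by simp

lemma orth_sho:
  assumes "X \<in> obj D" "Y \<in> obj D"
  shows "orth (sho D X) (sho D Y) \<longleftrightarrow> orth X Y"
proof
  assume "orth (sho D X) (sho D Y)"
  then have "f = hzero D X Y" if "f \<in> homset D X Y" for f
    using that orthD sha_hom sha_hzero sha_faithful hzero_hom assms by metis
  then show "orth X Y" by (auto simp: orth_def)
next
  assume "orth X Y"
  then have "f = hzero D (sho D X) (sho D Y)" if "f \<in> homset D (sho D X) (sho D Y)" for f
    using that sha_full[OF that assms] orthD sha_hzero assms by metis
  then show "orth (sho D X) (sho D Y)" by (auto simp: orth_def)
qed

lemma isomorphic_sho:
  assumes "X \<in> obj D" "Y \<in> obj D"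
  shows "isomorphic D (sho D X) (sho D Y) \<longleftrightarrow> isomorphic D X Y"
proof
  assume "isomorphic D (sho D X) (sho D Y)"
  then obtain f g where f: "f \<in> homset D (sho D X) (sho D Y)" "g \<in> homset D (sho D Y) (sho D X)"
    "g \<cdot> f = idn D (sho D X)" "f \<cdot> g = idn D (sho D Y)"
    using isomorphic_iff by auto
  obtain f0 g0 where f0: "f0 \<in> homset D X Y" "sha D f0 = f" and g0: "g0 \<in> homset D Y X"
    "sha D g0 = g"
    using sha_full f assms by metis
  have "g0 \<cdot> f0 = idn D X"
    using sha_faithful[OF cmp_hom[OF f0(1) g0(1)] idn_hom[OF assms(1)]]
      sha_cmp[OF f0(1) g0(1)] sha_idn[OF assms(1)] f0 g0 f by simp
  moreover have "f0 \<cdot> g0 = idn D Y"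
    using sha_faithful[OF cmp_hom[OF g0(1) f0(1)] idn_hom[OF assms(2)]]
      sha_cmp[OF g0(1) f0(1)] sha_idn[OF assms(2)] f0 g0 f by simp
  ultimately show "isomorphic D X Y" using f0 g0 isomorphic_iff by blast
next
  assume "isomorphic D X Y"
  then obtain f g where "f \<in> homset D X Y" "g \<in> homset D Y X" "g \<cdot> f = idn D X" "f \<cdot> g = idn D Y"
    using isomorphic_iff by auto
  then show "isomorphic D (sho D X) (sho D Y)"
    unfolding isomorphic_iff using sha_hom sha_cmp sha_idn assms by metis
qed

lemma zero_object_sho: "zero_object D Z \<Longrightarrow> zero_object D (sho D Z)"
  using orth_self_zero sho_obj orth_sho zero_objectD by metis

section \<open>Distinguished triangles\<close>

text \<open>A triangle in \<open>dist_tri\<close> is a triple of morphisms; naming its objects \<open>X \<rightarrow> Y \<rightarrow> Z \<rightarrow> X[1]\<close> lets rotation and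
  membership in subcategories be stated without sources and targets.\<close>

definition dtri :: "'o \<Rightarrow> 'o \<Rightarrow> 'o \<Rightarrow> 'm \<Rightarrow> 'm \<Rightarrow> 'm \<Rightarrow> bool" where
  "dtri X Y Z f g h \<longleftrightarrow> (f, g, h) \<in> dist_tri D \<and>
     f \<in> homset D X Y \<and> g \<in> homset D Y Z \<and> h \<in> homset D Z (sho D X)"

lemma dtriD:
  assumes "dtri X Y Z f g h"
  shows "(f, g, h) \<in> dist_tri D" "f \<in> homset D X Y" "g \<in> homset D Y Z" "h \<in> homset D Z (sho D X)"
    "X \<in> obj D" "Y \<in> obj D" "Z \<in> obj D"
  using assms hom_obj by (auto simp: dtri_def)

lemma triangle_homI:
  "\<lbrakk>f \<in> homset D X Y; g \<in> homset D Y Z; h \<in> homset D Z (sho D X)\<rbrakk> \<Longrightarrow> triangle D (f, g, h)"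
  by (auto simp: triangle_def homset_def)

lemma dtriI: "\<lbrakk>(f, g, h) \<in> dist_tri D; f \<in> homset D X Y; Z = tgt D g\<rbrakk> \<Longrightarrow> dtri X Y Z f g h"
  using dist_triangle[of "(f,g,h)"] by (auto simp: dtri_def triangle_def homset_def)

lemma star_iff:
  "A \<in> star D \<X> \<Y> \<longleftrightarrow> (\<exists>X \<in> \<X>. \<exists>Y \<in> \<Y>. \<exists>f g h. dtri X A Y f g h)"
  unfolding star_def dtri_def using hom_obj by blast

lemma starI: "\<lbrakk>dtri X A Y f g h; X \<in> \<X>; Y \<in> \<Y>\<rbrakk> \<Longrightarrow> A \<in> star D \<X> \<Y>"
  unfolding star_iff by blast

lemma dtri_rotate_iff:
  assumes "f \<in> homset D X Y" "g \<in> homset D Y Z" "h \<in> homset D Z (sho D X)"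
  shows "dtri X Y Z f g h \<longleftrightarrow> dtri Y Z (sho D X) g h (hneg D (sha D f))"
  using dist_rotate[OF triangle_homI[OF assms]] assms hneg_hom sha_hom by (auto simp: dtri_def)

lemma dtri_rotate: "dtri X Y Z f g h \<Longrightarrow> dtri Y Z (sho D X) g h (hneg D (sha D f))"
  using dtri_rotate_iff[OF dtriD(2-4)] by blast

lemma dtri_cone:
  assumes "f \<in> homset D X Y"
  obtains Z g h where "dtri X Y Z f g h"
proof -
  obtain g h where "(f, g, h) \<in> dist_tri D" using dist_ex[of f] assms by (auto simp: homset_def)
  then show thesis using that dtriI[OF _ assms refl] by blast
qed

text \<open>Three rotations shift a triangle and change the sign of all three maps. Because rotation can be
  undone, so can the shift of a triangle.\<close>

lemma dtri_sho_iff: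
  assumes "f \<in> homset D X Y" "g \<in> homset D Y Z" "h \<in> homset D Z (sho D X)"
  shows "dtri X Y Z f g h \<longleftrightarrow> dtri (sho D X) (sho D Y) (sho D Z)
    (hneg D (sha D f)) (hneg D (sha D g)) (hneg D (sha D h))"
  using dtri_rotate_iff assms hneg_hom sha_hom by metis

lemma dtri_sho:
  assumes "dtri X Y Z f g h"
  obtains f' g' h' where "dtri (sho D X) (sho D Y) (sho D Z) f' g' h'"
  using dtri_sho_iff dtriD assms by metis

text \<open>The maps come from the full faithfulness of the shift. The signs introduced by the three
  rotations are absorbed by taking negatives, as only the existence of the triangle matters.\<close>

lemma dtri_unsho:
  assumes "dtri (sho D X) (sho D Y) (sho D Z) f g h" "X \<in> obj D" "Y \<in> obj D" "Z \<in> obj D"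
  obtains f' g' h' where "dtri X Y Z f' g' h'"
proof -
  obtain f0 where f0: "f0 \<in> homset D X Y" "sha D f0 = f" using sha_full dtriD assms by metis
  obtain g0 where g0: "g0 \<in> homset D Y Z" "sha D g0 = g" using sha_full dtriD assms by metis
  obtain h0 where h0: "h0 \<in> homset D Z (sho D X)" "sha D h0 = h"
    using sha_full[of h Z "sho D X"] dtriD assms sho_obj by metis
  have "hneg D (sha D (hneg D a)) = sha D a" if "a \<in> homset D P Q" for a P Q
    using sha_hneg hneg_hneg that hneg_hom sha_hom by metis
  then have "dtri X Y Z (hneg D f0) (hneg D g0) (hneg D h0)"
    using dtri_sho_iff[of "hneg D f0" X Y "hneg D g0" Z "hneg D h0"] f0 g0 h0 hneg_hom assms(1)
    by metis
  then show thesis using that by blast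
qed

lemma dtri_map:
  assumes "dtri X Y Z f g h" "dtri X' Y' Z' f' g' h'"
    and "u \<in> homset D X X'" "v \<in> homset D Y Y'" "v \<cdot> f = f' \<cdot> u"
  obtains w where "w \<in> homset D Z Z'" "w \<cdot> g = g' \<cdot> v" "sha D u \<cdot> h = h' \<cdot> w"
proof -
  have "\<exists>w. triangle_map D (f, g, h) (f', g', h') (u, v, w)"
    using assms dist_map[of f g h f' g' h' u v] by (auto simp: dtri_def homset_def)
  then show thesis
    using that assms by (auto simp: triangle_map_def dtri_def homset_def)
qed

lemma dtri_idn: "\<lbrakk>X \<in> obj D; zero_object D Z\<rbrakk>
    \<Longrightarrow> dtri X X Z (idn D X) (hzero D X Z) (hzero D Z (sho D X))"
  using dist_idn idn_hom hzero_hom sho_obj zero_objectD(1) by (auto simp: dtri_def)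

lemma dtri_zero_idn:
  assumes "X \<in> obj D" "zero_object D Z"
  shows "dtri Z X X (hzero D Z X) (idn D X) (hzero D X (sho D Z))"
proof -
  have "dtri X X (sho D Z) (idn D X) (hzero D X (sho D Z)) (hneg D (sha D (hzero D Z X)))"
    using dtri_idn[OF assms(1) zero_object_sho[OF assms(2)]] assms
    by (simp add: sha_hzero hneg_hzero sho_obj zero_objectD(1))
  then show ?thesis
    using dtri_rotate_iff[of "hzero D Z X" Z X] assms hzero_hom idn_hom sho_obj zero_objectD(1)
    by metis
qed

text \<open>Exactness of \<open>Hom(T, X) \<rightarrow> Hom(T, Y) \<rightarrow> Hom(T, Z)\<close>. The morphism \<open>a\<close> is the first component of a
  morphism of triangles from \<open>T \<rightarrow> 0 \<rightarrow> T[1]\<close> to the rotated triangle; the third component is \<open>b[1]\<close>.\<close>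

lemma dtri_lift:
  assumes t: "dtri X Y Z f g h" and a: "a \<in> homset D T Y" and z: "g \<cdot> a = hzero D T Z"
  obtains b where "b \<in> homset D T X" "f \<cdot> b = a"
proof -
  obtain N where N: "zero_object D N" using ex_zero_object by auto
  note No = zero_objectD(1)[OF N]
  have T: "T \<in> obj D" using a hom_obj by auto
  note tX = dtriD[OF t]
  let ?t = "hneg D (sha D (idn D T))"
  have 1: "dtri T N (sho D T) (hzero D T N) (hzero D N (sho D T)) ?t"
    using dtri_rotate[OF dtri_idn[OF T N]] .
  have "hzero D N Z \<cdot> hzero D T N = g \<cdot> a"
    using z cmp_hzero_left hzero_hom T No tX by metis
  then obtain w where w: "w \<in> homset D (sho D T) (sho D X)"
    "sha D a \<cdot> ?t = hneg D (sha D f) \<cdot> w"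
    using dtri_map[OF 1 dtri_rotate[OF t] a hzero_hom[OF No tX(7)]] by blast
  obtain b where b: "b \<in> homset D T X" "sha D b = w"
    using sha_full[OF w(1) T tX(5)] .
  have "sha D a \<cdot> ?t = hneg D (sha D a)"
    using cmp_hneg_right[OF sha_hom[OF idn_hom[OF T]] sha_hom[OF a]] sha_idn T
      idn_right[OF sha_hom[OF a]] by simp
  moreover have "hneg D (sha D f) \<cdot> w = hneg D (sha D (f \<cdot> b))"
    using cmp_hneg_left[OF w(1) sha_hom[OF tX(2)]] sha_cmp[OF b(1) tX(2)] b by simp
  ultimately have "sha D a = sha D (f \<cdot> b)"
    using hneg_inj[OF sha_hom[OF a] sha_hom[OF cmp_hom[OF b(1) tX(2)]]] w(2) by metis
  then have "f \<cdot> b = a" using sha_faithful[OF a cmp_hom[OF b(1) tX(2)]] by simp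
  then show thesis using that b(1) by blast
qed

text \<open>Exactness of \<open>Hom(Z, T) \<rightarrow> Hom(Y, T) \<rightarrow> Hom(X, T)\<close>, from a morphism of triangles to
  \<open>0 \<rightarrow> T \<rightarrow> T\<close> with second component \<open>a\<close>.\<close>

lemma dtri_extend:
  assumes t: "dtri X Y Z f g h" and a: "a \<in> homset D Y T" and z: "a \<cdot> f = hzero D X T"
  obtains b where "b \<in> homset D Z T" "b \<cdot> g = a"
proof -
  obtain N where N: "zero_object D N" using ex_zero_object by auto
  note No = zero_objectD(1)[OF N]
  have T: "T \<in> obj D" using a hom_obj by auto
  note tX = dtriD[OF t]
  have "a \<cdot> f = hzero D N T \<cdot> hzero D X N"
    using z cmp_hzero_left hzero_hom T No tX by metis
  then obtain w where "w \<in> homset D Z T" "w \<cdot> g = idn D T \<cdot> a"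
    using dtri_map[OF t dtri_zero_idn[OF T N] hzero_hom[OF tX(5) No] a] by blast
  then show thesis using that idn_left[OF a] by simp
qed

lemma orth_into_middle:
  assumes t: "dtri X Y Z f g h" and "orth T X" "orth T Z"
  shows "orth T Y"
proof -
  have "a = hzero D T Y" if a: "a \<in> homset D T Y" for a
  proof -
    have "g \<cdot> a = hzero D T Z" using orthD assms(3) cmp_hom a dtriD(3)[OF t] by metis
    then obtain b where "b \<in> homset D T X" "f \<cdot> b = a" using dtri_lift[OF t a] by blast
    then show ?thesis using orthD[OF assms(2)] cmp_hzero_right dtriD(2)[OF t] a hom_obj by metis
  qed
  then show ?thesis by (auto simp: orth_def)
qed

lemma orth_from_middle:
  assumes t: "dtri X Y Z f g h" and "orth X T" "orth Z T"
  shows "orth Y T"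
proof -
  have "a = hzero D Y T" if a: "a \<in> homset D Y T" for a
  proof -
    have "a \<cdot> f = hzero D X T" using orthD assms(2) cmp_hom a dtriD(2)[OF t] by metis
    then obtain b where "b \<in> homset D Z T" "b \<cdot> g = a" using dtri_extend[OF t a] by blast
    then show ?thesis using orthD[OF assms(3)] cmp_hzero_left dtriD(3)[OF t] a hom_obj by metis
  qed
  then show ?thesis by (auto simp: orth_def)
qed

text \<open>As \<open>Z\<close> vanishes, the identity of \<open>Y\<close> lifts along \<open>f\<close> and the identity of \<open>X[1]\<close> extends along the
  shift of \<open>f\<close>. So \<open>f\<close> has a right and a left inverse.\<close>

lemma dtri_zero_right_iso:
  assumes t: "dtri X Y Z f g h" and Z: "zero_object D Z"
  shows "isomorphic D X Y"
proof -
  note tX = dtriD[OF t]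
  have iY: "idn D Y \<in> homset D Y Y" and iX: "idn D (sho D X) \<in> homset D (sho D X) (sho D X)"
    using idn_hom tX sho_obj by auto
  have "g \<cdot> idn D Y = hzero D Y Z"
    using orthD[OF zero_objectD(2)[OF Z tX(6)]] cmp_hom[OF iY tX(3)] by blast
  then obtain r where r: "r \<in> homset D Y X" "f \<cdot> r = idn D Y"
    using dtri_lift[OF t iY] by blast
  have "idn D (sho D X) \<cdot> h = hzero D Z (sho D X)"
    using orthD[OF zero_objectD(3)[OF Z sho_obj[OF tX(5)]]] cmp_hom[OF tX(4) iX] by blast
  then obtain c where c: "c \<in> homset D (sho D Y) (sho D X)"
      "c \<cdot> hneg D (sha D f) = idn D (sho D X)"
    using dtri_extend[OF dtri_rotate[OF dtri_rotate[OF t]] iX] by blast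
  obtain l where l: "l \<in> homset D Y X" "sha D l = hneg D c"
    using sha_full[OF hneg_hom[OF c(1)] tX(6) tX(5)] .
  have "sha D (l \<cdot> f) = sha D (idn D X)"
    using sha_cmp[OF tX(2) l(1)] l(2) c(2) cmp_hneg_left[OF sha_hom[OF tX(2)] c(1)]
      cmp_hneg_right[OF sha_hom[OF tX(2)] c(1)] sha_idn tX(5) by simp
  then have "l \<cdot> f = idn D X"
    using sha_faithful[OF cmp_hom[OF tX(2) l(1)] idn_hom[OF tX(5)]] by simp
  then show ?thesis using left_right_inverse[OF tX(2) l(1) r(1)] r(2) by simp
qed

lemma dtri_zero_left_iso:
  assumes t: "dtri X Y Z f g h" and X: "zero_object D X"
  shows "isomorphic D Y Z"
  using dtri_zero_right_iso[OF dtri_rotate[OF t] zero_object_sho[OF X]] .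

lemma dtri_iso_middle:
  assumes t: "dtri X Y Z f g h" and "isomorphic D Y Y'"
  obtains f' g' where "dtri X Y' Z f' g' h"
proof -
  note tX = dtriD[OF t]
  obtain p q where p: "p \<in> homset D Y Y'" "q \<in> homset D Y' Y" "q \<cdot> p = idn D Y" "p \<cdot> q = idn D Y'"
    using assms(2) isomorphic_iff by auto
  have 1: "p \<cdot> f \<in> homset D X Y'" "g \<cdot> q \<in> homset D Y' Z"
    using cmp_hom tX p by blast+
  have 2: "(g \<cdot> q) \<cdot> p = g"
    using cmp_assoc[OF p(1,2) tX(3)] p idn_right[OF tX(3)] by simp
  have "triangle_map D (f, g, h) (p \<cdot> f, g \<cdot> q, h) (idn D X, p, idn D Z)"
    using tX p 1 2 idn_left[OF tX(3)] idn_right[OF 1(1)] idn_left[OF tX(4)] idn_right[OF tX(4)]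
      idn_hom[OF tX(5)] idn_hom[OF tX(7)] sha_idn[OF tX(5)]
    by (simp add: triangle_map_def homset_def)
  then have "(p \<cdot> f, g \<cdot> q, h) \<in> dist_tri D"
    using dist_iso[OF tX(1) triangle_homI[OF 1 tX(4)]] iso_arrI[OF p] iso_idn tX(5,7) by blast
  then show thesis using that 1 tX(4) by (auto simp: dtri_def)
qed

lemma dtri_iso_right:
  assumes t: "dtri X Y Z f g h" and "isomorphic D Z Z'"
  obtains g' h' where "dtri X Y Z' f g' h'"
proof -
  note tX = dtriD[OF t]
  obtain p q where p: "p \<in> homset D Z Z'" "q \<in> homset D Z' Z" "q \<cdot> p = idn D Z" "p \<cdot> q = idn D Z'"
    using assms(2) isomorphic_iff by auto
  have 1: "p \<cdot> g \<in> homset D Y Z'" "h \<cdot> q \<in> homset D Z' (sho D X)"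
    using cmp_hom tX p by blast+
  have 2: "(h \<cdot> q) \<cdot> p = h"
    using cmp_assoc[OF p(1,2) tX(4)] p idn_right[OF tX(4)] by simp
  have "triangle_map D (f, g, h) (f, p \<cdot> g, h \<cdot> q) (idn D X, idn D Y, p)"
    using tX p 1 2 idn_left[OF tX(2)] idn_right[OF tX(2)] idn_right[OF 1(1)] idn_left[OF tX(4)]
      idn_hom[OF tX(5)] idn_hom[OF tX(6)] sha_idn[OF tX(5)]
    by (simp add: triangle_map_def homset_def)
  then have "(f, p \<cdot> g, h \<cdot> q) \<in> dist_tri D"
    using dist_iso[OF tX(1) triangle_homI[OF tX(2) 1]] iso_arrI[OF p] iso_idn tX(5,6) by blast
  then show thesis using that 1 tX(2) by (auto simp: dtri_def)
qed

text \<open>The third vertex of a triangle on \<open>g\<close> is, up to isomorphism, a shift \<open>X[1]\<close>, and rotating backwards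
  makes \<open>X\<close> the first vertex.\<close>

lemma dtri_fiber:
  assumes g: "g \<in> homset D Y Z"
  obtains X f h where "dtri X Y Z f g h"
proof -
  obtain C k l where "dtri Y Z C g k l" using dtri_cone[OF g] by blast
  moreover obtain X where X: "X \<in> obj D" "isomorphic D (sho D X) C"
    using sho_ess_surj[of C] dtriD(7) calculation by blast
  ultimately obtain k l where t: "dtri Y Z (sho D X) g k l"
    using dtri_iso_right isomorphic_sym by metis
  note tX = dtriD[OF t]
  obtain f where f: "f \<in> homset D X Y" "sha D f = l" using sha_full[OF tX(4) X(1) tX(5)] .
  have "hneg D (sha D (hneg D f)) = l"
    using sha_hneg f hneg_hneg hneg_hom sha_hom by metis
  then have "dtri X Y Z (hneg D f) g k"
    using dtri_rotate_iff[OF hneg_hom[OF f(1)] g tX(3)] t by simp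
  then show thesis using that by blast
qed

text \<open>The part of the octahedral axiom that transfers membership in subcategories: the triangle of
  the three cones.\<close>

lemma dtri_octahedral:
  assumes t1: "dtri X Y Z' f h k" and t2: "dtri Y Z X' g l m" and t3: "dtri X Z Y' (g \<cdot> f) n p"
  obtains u v w where "dtri Z' Y' X' u v w"
proof -
  have "tgt D f = src D g" using dtriD(2)[OF t1] dtriD(2)[OF t2] by (simp add: homset_def)
  then obtain u v where uv: "(u, v, sha D h \<cdot> m) \<in> dist_tri D"
      "triangle_map D (f, h, k) (g \<cdot> f, n, p) (idn D (src D f), g, u)"
      "triangle_map D (g \<cdot> f, n, p) (g, l, m) (f, idn D (tgt D g), v)"
    using octahedral dtriD(1) t1 t2 t3 by meson
  have "u \<in> homset D Z' Y'" "v \<in> homset D Y' X'"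
    using uv dtriD(4)[OF t1] dtriD(4)[OF t2] dtriD(4)[OF t3]
    by (auto simp: triangle_map_def homset_def)
  note h = this
  have "X' = tgt D v" using h(2) by (simp add: homset_def)
  then show thesis using that dtriI[OF uv(1) h(1)] by blast
qed

section \<open>Extensions of subcategories\<close>

text \<open>The two inclusions of the associativity of \<open>*\<close> are the octahedral axiom for \<open>X \<rightarrow> B \<rightarrow> A\<close> and for
  \<open>A \<rightarrow> C \<rightarrow> Z\<close>; the second one yields the shifts of the objects wanted.\<close>

lemma star_assoc_left:
  "star D (star D \<X> \<Y>) \<Z> \<subseteq> star D \<X> (star D \<Y> \<Z>)"
proof
  fix A assume "A \<in> star D (star D \<X> \<Y>) \<Z>"
  then obtain X B Y Z f h k g l m where t1: "dtri X B Y f h k" and t2: "dtri B A Z g l m"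
    and mem: "X \<in> \<X>" "Y \<in> \<Y>" "Z \<in> \<Z>"
    by (auto simp: star_iff)
  obtain C n p where t3: "dtri X A C (g \<cdot> f) n p"
    using dtri_cone cmp_hom dtriD(2) t1 t2 by metis
  obtain u v w where "dtri Y C Z u v w" using dtri_octahedral[OF t1 t2 t3] .
  then show "A \<in> star D \<X> (star D \<Y> \<Z>)" using t3 mem starI by metis
qed

lemma star_assoc_right:
  "star D \<X> (star D \<Y> \<Z>) \<subseteq> star D (star D \<X> \<Y>) \<Z>"
proof
  fix A assume "A \<in> star D \<X> (star D \<Y> \<Z>)"
  then obtain X C Y Z f q h e r k where t1: "dtri X A C f q h" and t2: "dtri Y C Z e r k"
    and mem: "X \<in> \<X>" "Y \<in> \<Y>" "Z \<in> \<Z>"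
    by (auto simp: star_iff)
  obtain B n p where t3: "dtri B A Z n (r \<cdot> q) p"
    using dtri_fiber cmp_hom dtriD(3) t1 t2 by metis
  \<comment> \<open>The cones of \<open>q\<close>, \<open>r \<cdot> q\<close> and \<open>r\<close> are \<open>X[1]\<close>, \<open>B[1]\<close> and \<open>Y[1]\<close>.\<close>
  obtain u v w where "dtri (sho D X) (sho D B) (sho D Y) u v w"
    using dtri_octahedral[OF dtri_rotate[OF t1] dtri_rotate[OF t2] dtri_rotate[OF t3]] .
  then obtain u' v' w' where "dtri X B Y u' v' w'"
    using dtri_unsho dtriD(5) t1 t2 t3 by metis
  then show "A \<in> star D (star D \<X> \<Y>) \<Z>" using t3 mem starI by metis
qed

lemma star_mono: "\<lbrakk>\<X> \<subseteq> \<X>'; \<Y> \<subseteq> \<Y>'\<rbrakk> \<Longrightarrow> star D \<X> \<Y> \<subseteq> star D \<X>' \<Y>'"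
  unfolding star_def by blast

lemma subcat_star: "subcat D (star D \<X> \<Y>)"
  unfolding subcat_def star_iff using dtri_iso_middle dtriD(6) by (metis star_iff subsetI)

lemma star_zero_right:
  assumes "zero_object D Z" "Z \<in> \<Y>" "\<X> \<subseteq> obj D"
  shows "\<X> \<subseteq> star D \<X> \<Y>"
  using starI[OF dtri_idn[OF _ assms(1)] _ assms(2)] assms(3) by blast

lemma star_zero_left:
  assumes "zero_object D Z" "Z \<in> \<X>" "\<Y> \<subseteq> obj D"
  shows "\<Y> \<subseteq> star D \<X> \<Y>"
  using starI[OF dtri_zero_idn[OF _ assms(1)] assms(2)] assms(3) by blast

section \<open>Triangulated subcategories\<close>

lemma homset_full_subcat:
  "\<lbrakk>X \<in> \<S>; Y \<in> \<S>\<rbrakk> \<Longrightarrow> homset (full_subcat D \<S>) X Y = homset D X Y"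
  by (auto simp: homset_def full_subcat_def)

lemma full_subcat_simps:
  "obj (full_subcat D \<S>) = \<S>" "cmp (full_subcat D \<S>) = cmp D" "idn (full_subcat D \<S>) = idn D"
  "sho (full_subcat D \<S>) = sho D" "hzero (full_subcat D \<S>) = hzero D"
  by (simp_all add: full_subcat_def)

lemma isomorphic_full_subcat:
  assumes "X \<in> \<S>" "Y \<in> \<S>"
  shows "isomorphic (full_subcat D \<S>) X Y \<longleftrightarrow> isomorphic D X Y"
proof -
  have "iso_arr (full_subcat D \<S>) f \<longleftrightarrow> iso_arr D f" if "f \<in> homset D X Y" for f
  proof -
    have f: "src D f = X" "tgt D f = Y" "f \<in> arr D" using that by (auto simp: homset_def)
    then show ?thesis
      using homset_full_subcat[OF assms(2) assms(1)] assms
      by (auto simp: iso_arr_def full_subcat_simps) (auto simp: full_subcat_def)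
  qed
  then show ?thesis unfolding isomorphic_def using homset_full_subcat[OF assms] by blast
qed

text \<open>The whole category is a triangulated subcategory of itself, so that statements about
  t-structures on triangulated subcategories cover the ambient category too.\<close>

lemma full_subcat_obj: "full_subcat D (obj D) = D"
proof -
  have "{f \<in> arr D. src D f \<in> obj D \<and> tgt D f \<in> obj D} = arr D"
    using src_obj tgt_obj by auto
  moreover have
    "{(f, g, h) \<in> dist_tri D. src D f \<in> obj D \<and> src D g \<in> obj D \<and> src D h \<in> obj D} = dist_tri D"
    using dist_triangle src_obj by (auto simp: triangle_def)
  ultimately show ?thesis by (simp add: full_subcat_def)
qed

lemma triangulated_subcat_obj: "triangulated_subcat D (obj D)"
  unfolding triangulated_subcat_def subcat_def
  using ex_zero_object zero_objectD(1) sho_obj dist_triangle tgt_obj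
  by (fastforce simp: triangle_def)

context
  fixes \<S> assumes S: "triangulated_subcat D \<S>"
begin

lemma subcat_triangulated: "subcat D \<S>" and triangulated_subcat_objD: "X \<in> \<S> \<Longrightarrow> X \<in> obj D"
  using S by (auto simp: triangulated_subcat_def subcat_def)

lemma triangulated_subcat_zero: "zero_object D Z \<Longrightarrow> Z \<in> \<S>"
  using S zero_isomorphic subcatD subcat_triangulated unfolding triangulated_subcat_def by metis

lemma triangulated_subcat_sho_iff: "X \<in> obj D \<Longrightarrow> sho D X \<in> \<S> \<longleftrightarrow> X \<in> \<S>"
  using S by (auto simp: triangulated_subcat_def)

lemma triangulated_subcat_cone:
  assumes "dtri X Y Z f g h" "X \<in> \<S>" "Y \<in> \<S>"
  shows "Z \<in> \<S>"
proof -
  have "\<forall>f g h. (f, g, h) \<in> dist_tri D \<longrightarrow> src D f \<in> \<S> \<longrightarrow> tgt D f \<in> \<S> \<longrightarrow> tgt D g \<in> \<S>"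
    using S by (simp add: triangulated_subcat_def)
  then show ?thesis using assms by (auto simp: dtri_def homset_def)
qed

text \<open>Two rotations exhibit \<open>Y[1]\<close> as the cone of a morphism \<open>Z \<rightarrow> X[1]\<close>.\<close>

lemma triangulated_subcat_extension:
  assumes t: "dtri X Y Z f g h" and "X \<in> \<S>" "Z \<in> \<S>"
  shows "Y \<in> \<S>"
  using triangulated_subcat_cone[OF dtri_rotate[OF dtri_rotate[OF t]] assms(3)]
    triangulated_subcat_sho_iff assms(2) dtriD(5,6)[OF t]
  by blast

lemma triangulated_subcat_fiber:
  assumes t: "dtri X Y Z f g h" and "Y \<in> \<S>" "Z \<in> \<S>"
  shows "X \<in> \<S>"
  using triangulated_subcat_cone[OF dtri_rotate[OF t] assms(2,3)]
    triangulated_subcat_sho_iff[OF dtriD(5)[OF t]] by simp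

end

section \<open>Shifts of subcategories\<close>

lemma subcat_iso_mem:
  "subcat D \<X> \<Longrightarrow> A \<in> obj D \<Longrightarrow> (\<exists>X \<in> \<X>. isomorphic D A X) \<longleftrightarrow> A \<in> \<X>"
  using subcatD isomorphic_sym isomorphic_refl by blast

lemma level_mono: "\<X> \<subseteq> \<Y> \<Longrightarrow> level D \<X> n \<subseteq> level D \<Y> n"
  unfolding level_def shifted_def by blast

lemma level_0: "subcat D \<X> \<Longrightarrow> level D \<X> 0 = \<X>"
  using subcat_iso_mem[of \<X>] by (auto simp: level_def shifted_def subcat_def)

lemma level_1: "subcat D \<X> \<Longrightarrow> level D \<X> 1 = {A \<in> obj D. sho D A \<in> \<X>}"
  using subcat_iso_mem[of \<X>] sho_obj by (auto simp: level_def shifted_def)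

lemma level_minus_1: "level D \<X> (- 1) = {A \<in> obj D. \<exists>X \<in> \<X>. isomorphic D A (sho D X)}"
  by (simp add: level_def shifted_def)

lemma level_obj: "level D \<X> n \<subseteq> obj D"
  by (auto simp: level_def shifted_def)

lemma sho_funpow_obj: "X \<in> obj D \<Longrightarrow> (sho D ^^ n) X \<in> obj D"
  by (induction n) (auto simp: sho_obj)

lemma level_minus:
  "level D \<X> (- int n) = {A \<in> obj D. \<exists>X \<in> \<X>. isomorphic D A ((sho D ^^ n) X)}"
  by (simp add: level_def shifted_def)

text \<open>An isomorphism \<open>A \<cong> X[n + 1]\<close> amounts to isomorphisms \<open>A \<cong> B[1]\<close> and \<open>B \<cong> X[n]\<close>.\<close>

lemma level_Suc:
  assumes "\<X> \<subseteq> obj D"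
  shows "level D \<X> (- int (Suc n)) = level D (level D \<X> (- int n)) (- 1)"
proof -
  have "isomorphic D A ((sho D ^^ Suc n) X) \<longleftrightarrow>
      (\<exists>B \<in> obj D. isomorphic D B ((sho D ^^ n) X) \<and> isomorphic D A (sho D B))" if "X \<in> \<X>" for A X
  proof -
    have X: "(sho D ^^ n) X \<in> obj D" using sho_funpow_obj that assms by blast
    show ?thesis
    proof
      assume "isomorphic D A ((sho D ^^ Suc n) X)"
      then show "\<exists>B \<in> obj D. isomorphic D B ((sho D ^^ n) X) \<and> isomorphic D A (sho D B)"
        using X isomorphic_refl[OF X] by auto
    next
      assume "\<exists>B \<in> obj D. isomorphic D B ((sho D ^^ n) X) \<and> isomorphic D A (sho D B)"
      then obtain B where B: "B \<in> obj D" "isomorphic D B ((sho D ^^ n) X)"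
        "isomorphic D A (sho D B)"
        by blast
      then show "isomorphic D A ((sho D ^^ Suc n) X)"
        using isomorphic_trans[OF B(3)] isomorphic_sho[OF B(1) X] by simp
    qed
  qed
  note eq = this
  have "A \<in> level D \<X> (- int (Suc n)) \<longleftrightarrow> A \<in> level D (level D \<X> (- int n)) (- 1)" for A
  proof -
    have "A \<in> level D \<X> (- int (Suc n)) \<longleftrightarrow> A \<in> obj D \<and>
        (\<exists>X \<in> \<X>. \<exists>B \<in> obj D. isomorphic D B ((sho D ^^ n) X) \<and> isomorphic D A (sho D B))"
      unfolding level_minus mem_Collect_eq by (simp only: eq cong: bex_cong)
    also have "\<dots> \<longleftrightarrow> A \<in> obj D \<and>
        (\<exists>B \<in> level D \<X> (- int n). isomorphic D A (sho D B))"
      unfolding level_minus by blast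
    also have "\<dots> \<longleftrightarrow> A \<in> level D (level D \<X> (- int n)) (- 1)"
      unfolding level_minus_1 by simp
    finally show ?thesis .
  qed
  then show ?thesis by blast
qed

lemma subcat_level_minus_1: "subcat D (level D \<X> (- 1))"
  unfolding level_minus_1 subcat_def using isomorphic_trans isomorphic_sym by blast

lemma subcat_level_1:
  assumes X: "subcat D \<X>"
  shows "subcat D (level D \<X> 1)"
proof -
  have "sho D B \<in> \<X>" if "A \<in> obj D" "sho D A \<in> \<X>" "B \<in> obj D" "isomorphic D A B" for A B
    using subcatD[OF X that(2)] isomorphic_sho[OF that(1,3)] that(4) by blast
  then show ?thesis unfolding subcat_def level_1[OF X] by blast
qed

text \<open>Shifting down and up again recovers an isomorphism-closed subcategory. Hence a coaisle and its
  strict coaisle determine each other.\<close>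

lemma level_up_down:
  assumes X: "subcat D \<X>"
  shows "level D (level D \<X> 1) (- 1) = \<X>"
proof -
  have "A \<in> \<X> \<longleftrightarrow> (\<exists>B \<in> obj D. sho D B \<in> \<X> \<and> isomorphic D A (sho D B))" if "A \<in> obj D" for A
    using sho_ess_surj[OF that] isomorphic_sym subcatD[OF X] by metis
  moreover have "\<X> \<subseteq> obj D" using X by (simp add: subcat_def)
  ultimately show ?thesis unfolding level_minus_1 level_1[OF X] by blast
qed

lemma level_down_up:
  assumes X: "subcat D \<X>"
  shows "level D (level D \<X> (- 1)) 1 = \<X>"
proof -
  have sub: "\<X> \<subseteq> obj D" using X by (simp add: subcat_def)
  have "(\<exists>B \<in> \<X>. isomorphic D (sho D A) (sho D B)) \<longleftrightarrow> A \<in> \<X>" if "A \<in> obj D" for A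
  proof -
    have "(\<exists>B \<in> \<X>. isomorphic D (sho D A) (sho D B)) \<longleftrightarrow> (\<exists>B \<in> \<X>. isomorphic D A B)"
      using isomorphic_sho[OF that] sub by blast
    then show ?thesis using subcat_iso_mem[OF X that] by simp
  qed
  then show ?thesis
    using sub sho_obj unfolding level_1[OF subcat_level_minus_1] unfolding level_minus_1 by blast
qed

lemma triangulated_subcat_funpow_iff:
  assumes "triangulated_subcat D \<S>" "X \<in> obj D"
  shows "(sho D ^^ n) X \<in> \<S> \<longleftrightarrow> X \<in> \<S>"
  using assms by (induction n) (simp_all add: triangulated_subcat_sho_iff sho_funpow_obj)

lemma level_minus_Int:
  assumes S: "triangulated_subcat D \<S>" and "\<X> \<subseteq> obj D"
  shows "level D (\<S> \<inter> \<X>) (- int n) = \<S> \<inter> level D \<X> (- int n)"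
proof -
  have "X \<in> \<S> \<longleftrightarrow> A \<in> \<S>" if "X \<in> \<X>" "isomorphic D A ((sho D ^^ n) X)" for A X
    using subcatD[OF subcat_triangulated[OF S]] that isomorphic_sym
      triangulated_subcat_funpow_iff[OF S, of X n] assms(2) by blast
  then show ?thesis unfolding level_minus by blast
qed

lemma level_1_Int:
  assumes S: "triangulated_subcat D \<S>" and X: "subcat D \<X>" "subcat D (\<S> \<inter> \<X>)"
  shows "level D (\<S> \<inter> \<X>) 1 = \<S> \<inter> level D \<X> 1"
  unfolding level_1[OF X(1)] level_1[OF X(2)]
  using triangulated_subcat_sho_iff[OF S] triangulated_subcat_objD[OF S] by blast

lemma subcat_Int: "\<lbrakk>subcat D \<X>; subcat D \<Y>\<rbrakk> \<Longrightarrow> subcat D (\<X> \<inter> \<Y>)"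
  unfolding subcat_def by blast

section \<open>Aisles and strict coaisles\<close>

text \<open>\<open>\<X>\<close> is an aisle of the triangulated subcategory \<open>\<S>\<close> and \<open>\<W>\<close> its strict coaisle, the objects of
  degree \<open>\<ge> 1\<close>. All conditions refer to the ambient category, so pairs in \<open>\<S>\<close> and in \<open>D\<close> can be
  compared directly; and with the strict coaisle, orthogonality and truncation involve no shift.\<close>

definition aisle_pair :: "'o set \<Rightarrow> 'o set \<Rightarrow> 'o set \<Rightarrow> bool" where
  "aisle_pair \<S> \<X> \<W> \<longleftrightarrow> subcat D \<X> \<and> subcat D \<W> \<and> \<X> \<subseteq> \<S> \<and> \<W> \<subseteq> \<S> \<and>
     (\<forall>A \<in> \<X>. \<forall>B \<in> \<W>. orth A B) \<and> \<S> \<subseteq> star D \<X> \<W> \<and> (\<forall>A \<in> \<X>. sho D A \<in> \<X>)"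

lemma aisle_pairD:
  assumes "aisle_pair \<S> \<X> \<W>"
  shows "subcat D \<X>" "subcat D \<W>" "\<X> \<subseteq> \<S>" "\<W> \<subseteq> \<S>"
    "\<lbrakk>A \<in> \<X>; B \<in> \<W>\<rbrakk> \<Longrightarrow> orth A B" "A \<in> \<X> \<Longrightarrow> sho D A \<in> \<X>"
    "A \<in> \<X> \<Longrightarrow> A \<in> obj D" "B \<in> \<W> \<Longrightarrow> B \<in> obj D"
  using assms by (auto simp: aisle_pair_def subcat_def)

lemma aisle_pair_truncate:
  assumes "aisle_pair \<S> \<X> \<W>" "A \<in> \<S>"
  obtains P Q f g h where "P \<in> \<X>" "Q \<in> \<W>" "dtri P A Q f g h"
proof -
  have "A \<in> star D \<X> \<W>" using assms unfolding aisle_pair_def by blast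
  then show thesis using that unfolding star_iff by blast
qed

context
  fixes \<S> \<X> \<W>
  assumes S: "triangulated_subcat D \<S>" and XW: "aisle_pair \<S> \<X> \<W>"
begin

text \<open>The cone \<open>Q\<close> of the truncation \<open>P \<rightarrow> A\<close> sits between \<open>A\<close> and \<open>P[1]\<close>, which have no nonzero morphisms
  to \<open>Q\<close>. So \<open>Q\<close> has no nonzero endomorphism and vanishes.\<close>

lemma aisleI:
  assumes "A \<in> \<S>" and A: "\<And>B. B \<in> \<W> \<Longrightarrow> orth A B"
  shows "A \<in> \<X>"
proof -
  obtain P Q f g h where t: "P \<in> \<X>" "Q \<in> \<W>" "dtri P A Q f g h"
    using aisle_pair_truncate XW assms(1) by metis
  have "orth Q Q"
    using orth_from_middle[OF dtri_rotate[OF t(3)] A[OF t(2)]] aisle_pairD(5,6)[OF XW] t by blast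
  then have "isomorphic D P A"
    using dtri_zero_right_iso[OF t(3)] orth_self_zero dtriD(7)[OF t(3)] by blast
  then show ?thesis using subcatD aisle_pairD(1)[OF XW] t(1) by blast
qed

text \<open>The dual argument: \<open>P[1]\<close> sits between \<open>Q\<close> and \<open>A[1]\<close>, and neither receives a nonzero morphism
  from \<open>P[1]\<close>.\<close>

lemma coaisleI:
  assumes "A \<in> \<S>" and A: "\<And>B. B \<in> \<X> \<Longrightarrow> orth B A"
  shows "A \<in> \<W>"
proof -
  obtain P Q f g h where t: "P \<in> \<X>" "Q \<in> \<W>" "dtri P A Q f g h"
    using aisle_pair_truncate XW assms(1) by metis
  have "orth (sho D P) (sho D A)" "orth (sho D P) Q"
    using orth_sho A t dtriD(5,6)[OF t(3)] aisle_pairD(5,6)[OF XW] by blast+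
  then have "orth (sho D P) (sho D P)"
    using orth_into_middle[OF dtri_rotate[OF dtri_rotate[OF t(3)]]] by blast
  then have "zero_object D P"
    using orth_sho orth_self_zero dtriD(5)[OF t(3)] by blast
  then have "isomorphic D A Q" using dtri_zero_left_iso[OF t(3)] by blast
  then show ?thesis using subcatD aisle_pairD(2)[OF XW] t(2) isomorphic_sym by blast
qed

lemma zero_in_aisle: "zero_object D Z \<Longrightarrow> Z \<in> \<X>"
  using aisleI triangulated_subcat_zero[OF S] zero_objectD aisle_pairD(8)[OF XW] by blast

lemma zero_in_coaisle: "zero_object D Z \<Longrightarrow> Z \<in> \<W>"
  using coaisleI triangulated_subcat_zero[OF S] zero_objectD aisle_pairD(7)[OF XW] by blast

lemma aisle_extension:
  assumes "dtri A B C f g h" "A \<in> \<X>" "C \<in> \<X>"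
  shows "B \<in> \<X>"
  using aisleI triangulated_subcat_extension[OF S assms(1)] orth_from_middle[OF assms(1)]
    aisle_pairD[OF XW] assms(2,3) by blast

lemma coaisle_extension:
  assumes "dtri A B C f g h" "A \<in> \<W>" "C \<in> \<W>"
  shows "B \<in> \<W>"
  using coaisleI triangulated_subcat_extension[OF S assms(1)] orth_into_middle[OF assms(1)]
    aisle_pairD[OF XW] assms(2,3) by blast

lemma aisle_cone:
  assumes "dtri A B C f g h" "A \<in> \<X>" "B \<in> \<X>"
  shows "C \<in> \<X>"
  using aisle_extension[OF dtri_rotate[OF assms(1)]] aisle_pairD(6)[OF XW] assms by blast

text \<open>The strict coaisle is the right orthogonal of an aisle closed under \<open>[1]\<close>, hence closed
  under \<open>[-1]\<close>.\<close>

lemma coaisle_unshift: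
  assumes "A \<in> obj D" "sho D A \<in> \<W>"
  shows "A \<in> \<W>"
proof (rule coaisleI)
  show "A \<in> \<S>" using assms triangulated_subcat_sho_iff[OF S] aisle_pairD(4)[OF XW] by blast
  show "orth B A" if "B \<in> \<X>" for B
    using orth_sho[of B A] that aisle_pairD(5-7)[OF XW] assms by blast
qed

text \<open>Intuitively \<open>A\<close> is an extension of \<open>B\<close> by \<open>C[-1]\<close>. To avoid the inverse shift, orthogonality is tested
  after applying \<open>[1]\<close>.\<close>

lemma coaisle_fiber:
  assumes t: "dtri A B C f g h" and "B \<in> \<W>" "C \<in> \<W>"
  shows "A \<in> \<W>"
proof (rule coaisleI)
  have "sho D A \<in> \<S>"
    using triangulated_subcat_cone[OF S dtri_rotate[OF t]] assms(2,3) aisle_pairD(4)[OF XW] by blast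
  then show "A \<in> \<S>" using triangulated_subcat_sho_iff[OF S] dtriD(5)[OF t] by blast
next
  fix T assume T: "T \<in> \<X>"
  have "orth (sho D T) (sho D B)"
    using orth_sho aisle_pairD(5)[OF XW T assms(2)] aisle_pairD(7)[OF XW T] dtriD(6)[OF t] by blast
  moreover have "orth (sho D T) C"
    using aisle_pairD(5)[OF XW aisle_pairD(6)[OF XW T] assms(3)] .
  ultimately have "orth (sho D T) (sho D A)"
    using orth_into_middle[OF dtri_rotate[OF dtri_rotate[OF t]]] by blast
  then show "orth T A" using orth_sho aisle_pairD(7)[OF XW T] dtriD(5)[OF t] by blast
qed

lemma aisle_shift_subset: "level D \<X> (- 1) \<subseteq> \<X>"
  unfolding level_minus_1 using aisle_pairD[OF XW] subcatD isomorphic_sym by blast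

lemma coaisle_shift_superset: "\<W> \<subseteq> level D \<W> (- 1)"
proof
  fix A assume A: "A \<in> \<W>"
  obtain B where B: "B \<in> obj D" "isomorphic D (sho D B) A"
    using sho_ess_surj aisle_pairD(8)[OF XW A] by blast
  then have "sho D B \<in> \<W>" using A subcatD isomorphic_sym aisle_pairD(2)[OF XW] by blast
  then show "A \<in> level D \<W> (- 1)"
    using coaisle_unshift B isomorphic_sym aisle_pairD(8)[OF XW A] unfolding level_minus_1 by blast
qed

lemma aisle_pair_shift: "aisle_pair \<S> (level D \<X> (- 1)) (level D \<W> (- 1))"
proof -
  have 1: "level D \<Y> (- 1) \<subseteq> \<S>" if "\<Y> \<subseteq> \<S>" for \<Y>
    unfolding level_minus_1
    using that triangulated_subcat_sho_iff[OF S] subcatD[OF subcat_triangulated[OF S]]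
      isomorphic_sym triangulated_subcat_objD[OF S] by blast
  have 2: "orth A B" if AB: "A \<in> level D \<X> (- 1)" "B \<in> level D \<W> (- 1)" for A B
  proof -
    obtain A' B' where "A' \<in> \<X>" "isomorphic D A (sho D A')" "B' \<in> \<W>" "isomorphic D B (sho D B')"
      using AB unfolding level_minus_1 by blast
    moreover from this have "orth (sho D A') (sho D B')"
      using orth_sho aisle_pairD(5,7,8)[OF XW] by blast
    ultimately show ?thesis using orth_iso_left orth_iso_right isomorphic_sym by blast
  qed
  have 3: "A \<in> star D (level D \<X> (- 1)) (level D \<W> (- 1))" if A: "A \<in> \<S>" for A
  proof -
    obtain B where B: "B \<in> obj D" "isomorphic D (sho D B) A"
      using sho_ess_surj triangulated_subcat_objD[OF S A] by blast
    then have "B \<in> \<S>"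
      using triangulated_subcat_sho_iff[OF S] A subcatD[OF subcat_triangulated[OF S]] isomorphic_sym
      by blast
    then obtain P Q f g h where t: "P \<in> \<X>" "Q \<in> \<W>" "dtri P B Q f g h"
      using aisle_pair_truncate XW by metis
    obtain f' g' h' where "dtri (sho D P) (sho D B) (sho D Q) f' g' h'" using dtri_sho[OF t(3)] .
    moreover have "sho D P \<in> level D \<X> (- 1)" "sho D Q \<in> level D \<W> (- 1)"
      unfolding level_minus_1 using t isomorphic_refl sho_obj dtriD[OF t(3)] by blast+
    ultimately show ?thesis using starI subcatD[OF subcat_star] B(2) by blast
  qed
  have 4: "sho D A \<in> level D \<X> (- 1)" if "A \<in> level D \<X> (- 1)" for A
  proof -
    have "A \<in> \<X>" "A \<in> obj D" using that aisle_shift_subset level_obj by blast+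
    then show ?thesis unfolding level_minus_1 using isomorphic_refl sho_obj by blast
  qed
  show ?thesis
    unfolding aisle_pair_def
    by (intro conjI ballI subsetI subcat_level_minus_1 2 3 4)
      (use 1 aisle_pairD(3,4)[OF XW] in auto)
qed

end

lemma aisle_pair_level:
  assumes "triangulated_subcat D \<S>" "aisle_pair \<S> \<X> \<W>"
  shows "aisle_pair \<S> (level D \<X> (- int n)) (level D \<W> (- int n))"
proof (induction n)
  case 0
  then show ?case using assms level_0 aisle_pairD(1,2) by simp
next
  case (Suc n)
  have "\<X> \<subseteq> obj D" "\<W> \<subseteq> obj D" using assms(2) aisle_pairD(7,8) by blast+
  then show ?case using aisle_pair_shift[OF assms(1) Suc] level_Suc by metis
qed

lemma aisle_level_subset:
  assumes "triangulated_subcat D \<S>" "aisle_pair \<S> \<X> \<W>"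
  shows "level D \<X> (- int n) \<subseteq> \<X>"
proof (induction n)
  case 0
  then show ?case using assms(2) level_0 aisle_pairD(1) by simp
next
  case (Suc n)
  have "\<X> \<subseteq> obj D" using assms(2) aisle_pairD(7) by blast
  then show ?case
    using aisle_shift_subset[OF assms(1) aisle_pair_level[OF assms]] level_Suc Suc
    by (metis subset_trans)
qed

lemma coaisle_level_superset:
  assumes "triangulated_subcat D \<S>" "aisle_pair \<S> \<X> \<W>"
  shows "level D \<W> (- int n) \<subseteq> level D \<W> (- int (Suc n))"
proof -
  have "\<W> \<subseteq> obj D" using assms(2) aisle_pairD(8) by blast
  then show ?thesis
    using coaisle_shift_superset[OF assms(1) aisle_pair_level[OF assms]] level_Suc by metis
qed

lemma coaisle_level_mono:
  assumes "triangulated_subcat D \<S>" "aisle_pair \<S> \<X> \<W>" "i \<le> j"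
  shows "level D \<W> (- int i) \<subseteq> level D \<W> (- int j)"
  using
    lift_Suc_mono_le[of "\<lambda>n. level D \<W> (- int n)", OF coaisle_level_superset[OF assms(1,2)] assms(3)] .

lemma coaisle_unique:
  assumes "triangulated_subcat D \<S>" "aisle_pair \<S> \<X> \<W>" "aisle_pair \<S> \<X> \<W>'"
  shows "\<W> = \<W>'"
  using coaisleI[OF assms(1)] assms(2,3) aisle_pairD(4,5) by (metis subsetD subsetI subset_antisym)

section \<open>Aisle pairs as t-structures\<close>

text \<open>The condition \<open>\<U>\<^sup>\<ge>\<^sup>1 \<subseteq> \<U>\<^sup>\<ge>\<^sup>0\<close> of a t-structure has no counterpart on the right because it
  follows from orthogonality (\<open>coaisle_shift_superset\<close>).\<close>

lemma t_structure_full_subcat_iff: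
  assumes S: "triangulated_subcat D \<S>"
  shows "t_structure (full_subcat D \<S>) (\<Y>, \<Z>) \<longleftrightarrow>
    subcat D \<Z> \<and> \<Z> \<subseteq> \<S> \<and> aisle_pair \<S> \<Y> (level D \<Z> 1)"
proof -
  let ?F = "full_subcat D \<S>"
  have sub: "subcat ?F \<X> \<longleftrightarrow> subcat D \<X> \<and> \<X> \<subseteq> \<S>" for \<X>
    unfolding subcat_def full_subcat_simps
    using isomorphic_full_subcat[of _ \<S>] triangulated_subcat_objD[OF S]
      subcatD[OF subcat_triangulated[OF S]] by blast
  have lev: "level ?F \<X> 1 = level D \<X> 1" if "subcat D \<X>" "\<X> \<subseteq> \<S>" for \<X>
  proof -
    have "isomorphic ?F (sho D A) X \<longleftrightarrow> isomorphic D (sho D A) X" if "A \<in> \<S>" "X \<in> \<X>" for A X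
      using isomorphic_full_subcat[of "sho D A" \<S> X] that triangulated_subcat_sho_iff[OF S]
        triangulated_subcat_objD[OF S] \<open>\<X> \<subseteq> \<S>\<close> by blast
    then have "level ?F \<X> 1 = {A \<in> \<S>. \<exists>X \<in> \<X>. isomorphic D (sho D A) X}"
      by (auto simp: level_def shifted_def full_subcat_simps)
    also have "\<dots> = {A \<in> obj D. sho D A \<in> \<X>}"
      using that subcatD[OF that(1)] isomorphic_sym isomorphic_refl sho_obj
        triangulated_subcat_sho_iff[OF S] triangulated_subcat_objD[OF S]
      by blast
    finally show ?thesis using level_1[OF that(1)] by simp
  qed
  have st: "star ?F \<X> \<W> = \<S> \<inter> star D \<X> \<W>" if "\<X> \<subseteq> \<S>" "\<W> \<subseteq> \<S>" for \<X> \<W>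
  proof -
    have
      "((f, g, h) \<in> dist_tri ?F \<and> f \<in> homset ?F X A \<and> g \<in> homset ?F A Y \<and> h \<in> homset ?F Y (sho D X))
      \<longleftrightarrow> ((f, g, h) \<in> dist_tri D \<and> f \<in> homset D X A \<and> g \<in> homset D A Y \<and> h \<in> homset D Y (sho D X))"
      if "X \<in> \<S>" "A \<in> \<S>" "Y \<in> \<S>" for X A Y f g h
      using that triangulated_subcat_sho_iff[OF S] triangulated_subcat_objD[OF S]
      by (auto simp: full_subcat_def homset_def)
    then show ?thesis
      unfolding star_def full_subcat_simps using that triangulated_subcat_objD[OF S] by blast
  qed
  show ?thesis
  proof
    assume t: "t_structure ?F (\<Y>, \<Z>)"
    have YZ: "subcat D \<Y>" "\<Y> \<subseteq> \<S>" "subcat D \<Z>" "\<Z> \<subseteq> \<S>"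
      using t sub by (auto simp: t_structure_def)
    note lev = lev[OF YZ(1,2)] lev[OF YZ(3,4)]
    have Z1: "level D \<Z> 1 \<subseteq> \<Z>" using t lev by (auto simp: t_structure_def)
    have "orth X Y" if "X \<in> \<Y>" "Y \<in> level D \<Z> 1" for X Y
    proof -
      have "homset ?F X Y = {hzero D X Y}"
        using t lev that by (simp add: t_structure_def full_subcat_simps)
      then show ?thesis
        using homset_full_subcat[of X \<S> Y] that YZ Z1 unfolding orth_def by blast
    qed
    moreover have "\<S> \<subseteq> star D \<Y> (level D \<Z> 1)"
      using t lev st[OF YZ(2)] YZ(4) Z1 by (auto simp: t_structure_def full_subcat_simps)
    moreover have "sho D A \<in> \<Y>" if "A \<in> \<Y>" for A
      using t lev that level_1[OF YZ(1)] by (auto simp: t_structure_def)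
    ultimately show "subcat D \<Z> \<and> \<Z> \<subseteq> \<S> \<and> aisle_pair \<S> \<Y> (level D \<Z> 1)"
      unfolding aisle_pair_def using YZ Z1 subcat_level_1 by blast
  next
    assume a: "subcat D \<Z> \<and> \<Z> \<subseteq> \<S> \<and> aisle_pair \<S> \<Y> (level D \<Z> 1)"
    then have Z: "subcat D \<Z>" "\<Z> \<subseteq> \<S>" and ap: "aisle_pair \<S> \<Y> (level D \<Z> 1)" by auto
    note apD = aisle_pairD[OF ap]
    have Z1: "level D \<Z> 1 \<subseteq> \<Z>"
      using coaisle_shift_superset[OF S ap] level_up_down[OF Z(1)] by simp
    have "homset ?F X Y = {hzero D X Y}" if "X \<in> \<Y>" "Y \<in> level D \<Z> 1" for X Y
      using homset_full_subcat[of X \<S> Y] apD(5)[OF that] that apD(3,4,7,8) hzero_hom[of X Y]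
      unfolding orth_def by blast
    then show "t_structure ?F (\<Y>, \<Z>)"
      using sub lev[OF apD(1,3)] lev[OF Z] st[OF apD(3,4)] Z Z1 apD(1,3,6,7) level_1[OF apD(1)] ap
      unfolding t_structure_def aisle_pair_def full_subcat_simps by auto
  qed
qed

lemma t_structure_aisle_eq:
  assumes S: "triangulated_subcat D \<S>"
    and "t_structure (full_subcat D \<S>) (\<Y>, \<Z>)" "t_structure (full_subcat D \<S>) (\<Y>, \<Z>')"
  shows "\<Z> = \<Z>'"
proof -
  have Z: "subcat D \<Z>" "subcat D \<Z>'"
    and "aisle_pair \<S> \<Y> (level D \<Z> 1)" "aisle_pair \<S> \<Y> (level D \<Z>' 1)"
    using assms(2,3) unfolding t_structure_full_subcat_iff[OF S] by blast+
  then have "level D \<Z> 1 = level D \<Z>' 1" using coaisle_unique[OF S] by blast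
  then show ?thesis using level_up_down[OF Z(1)] level_up_down[OF Z(2)] by metis
qed

end

section \<open>Aisles between an aisle and its shift\<close>

locale heart_in_subcat = triangulated_category D
  for D :: "('o, 'm, 'a) tri_cat_scheme" (structure) +
  fixes \<U> \<V> \<S> :: "'o set" and m :: nat
  assumes t_UV: "t_structure D (\<U>, \<V>)"
    and m_pos: "m > 0"
    and S: "triangulated_subcat D \<S>"
    and t_S: "t_structure (full_subcat D \<S>) (\<S> \<inter> \<U>, \<S> \<inter> \<V>)"
    and heart_S: "heart (\<U>, \<V>) \<subseteq> \<S>"
begin

text \<open>In terms of the given t-structure, \<open>\<U>\<^sub>m = \<U>\<^sup>\<le>\<^sup>-\<^sup>m\<close>, \<open>\<W> = \<U>\<^sup>\<ge>\<^sup>1\<close> and \<open>\<W>\<^sub>m = \<U>\<^sup>\<ge>\<^sup>1\<^sup>-\<^sup>m\<close>.\<close>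

abbreviation "\<U>\<^sub>m \<equiv> level D \<U> (- int m)"
abbreviation "\<W> \<equiv> level D \<V> 1"
abbreviation "\<W>\<^sub>m \<equiv> level D \<W> (- int m)"

lemma t_iff: "t_structure D (\<X>, \<Z>) \<longleftrightarrow> subcat D \<Z> \<and> aisle_pair (obj D) \<X> (level D \<Z> 1)"
  using t_structure_full_subcat_iff[OF triangulated_subcat_obj]
  by (auto simp: full_subcat_obj subcat_def)

lemma subcat_V: "subcat D \<V>" and UW: "aisle_pair (obj D) \<U> \<W>"
  using t_UV t_iff by auto

lemma SUW: "aisle_pair \<S> (\<S> \<inter> \<U>) (\<S> \<inter> \<W>)"
  using t_S level_1_Int[OF S subcat_V] t_structure_full_subcat_iff[OF S] by auto

lemmas UWm = aisle_pair_level[OF triangulated_subcat_obj UW]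

lemma SUWm: "aisle_pair \<S> (\<S> \<inter> \<U>\<^sub>m) (\<S> \<inter> \<W>\<^sub>m)"
proof -
  have "\<U> \<subseteq> obj D" using aisle_pairD(3)[OF UW] .
  then show ?thesis
    using aisle_pair_level[OF S SUW, of m] level_minus_Int[OF S] level_obj by metis
qed

lemma Um_sub: "\<U>\<^sub>m \<subseteq> \<U>"
  using aisle_level_subset[OF triangulated_subcat_obj UW] .

text \<open>Here \<open>\<U> \<inter> \<W>[n + 1]\<close> consists of the objects living in degrees \<open>-n, \<dots>, 0\<close>. For \<open>n = 0\<close> this is
  the heart. In the induction step, the truncation \<open>P \<rightarrow> E \<rightarrow> Q\<close> for \<open>(\<U>[1], \<W>[1])\<close> splits off the
  part \<open>Q\<close> in degree \<open>0\<close>, which lies in the heart, and \<open>P\<close> is the shift of an object with fewer degrees.\<close>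

lemma extended_heart_subset: "\<U> \<inter> level D \<W> (- int (Suc n)) \<subseteq> \<S>"
proof (induction n)
  case 0
  then show ?case using heart_S level_up_down[OF subcat_V] by (simp add: heart_def)
next
  case (Suc n)
  show ?case
  proof
    fix E assume E: "E \<in> \<U> \<inter> level D \<W> (- int (Suc (Suc n)))"
    note W = aisle_pairD(4)[OF UW]
    have 1: "level D \<X> (- int 1) = level D \<X> (- 1)" for \<X> by simp
    have E': "E \<in> obj D" using E aisle_pairD(7)[OF UW] by blast
    obtain P Q f g h where t: "P \<in> level D \<U> (- int 1)" "Q \<in> level D \<W> (- int 1)" "dtri P E Q f g h"
      using aisle_pair_truncate[OF UWm E'] by metis
    have "Q \<in> \<U>"
      using aisle_cone[OF triangulated_subcat_obj UW t(3)]
        aisle_level_subset[OF triangulated_subcat_obj UW] t(1) E by blast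
    then have Q: "Q \<in> \<S>"
      using heart_S t(2) level_up_down[OF subcat_V] unfolding 1 by (auto simp: heart_def)
    have "Q \<in> level D \<W> (- int (Suc (Suc n)))"
      using coaisle_level_mono[OF triangulated_subcat_obj UW, of 1 "Suc (Suc n)"] t(2) by auto
    then have P: "P \<in> level D \<W> (- int (Suc (Suc n)))"
      using coaisle_fiber[OF triangulated_subcat_obj UWm t(3)] E by blast
    obtain P0 where P0: "P0 \<in> \<U>" "isomorphic D P (sho D P0)"
      using t(1) unfolding 1 level_minus_1 by blast
    have P0': "P0 \<in> obj D" using P0 aisle_pairD(7)[OF UW] by blast
    have "sho D P0 \<in> level D (level D \<W> (- int (Suc n))) (- 1)"
      using subcatD[OF aisle_pairD(2)[OF UWm] P P0(2)] unfolding level_Suc[OF W, of "Suc n"] .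
    then have "P0 \<in> level D \<W> (- int (Suc n))"
      using level_down_up[OF aisle_pairD(2)[OF UWm], of "Suc n"] P0'
      unfolding level_1[OF subcat_level_minus_1] by blast
    then have "P0 \<in> \<S>" using Suc P0(1) by blast
    then have "P \<in> \<S>"
      using triangulated_subcat_sho_iff[OF S P0'] subcatD[OF subcat_triangulated[OF S]]
        isomorphic_sym[OF P0(2)] by blast
    then show "E \<in> \<S>" using triangulated_subcat_extension[OF S t(3)] Q by blast
  qed
qed

lemma bounded_in_subcat: "\<lbrakk>E \<in> \<U>; E \<in> \<W>\<^sub>m\<rbrakk> \<Longrightarrow> E \<in> \<S>"
  using extended_heart_subset[of "m - 1"] m_pos by auto

text \<open>Only the truncations need an argument: the triangle of \<open>A \<in> \<S>\<close> for \<open>(\<X>, \<W>')\<close> must lie in \<open>\<S>\<close>. Its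
  first vertex \<open>X\<close> is compared with the truncation \<open>P\<close> of \<open>A\<close> for \<open>(\<U>\<^sub>m, \<W>\<^sub>m)\<close>, known to lie in \<open>\<S>\<close>. The
  difference \<open>E\<close> is in \<open>\<U>\<close> as a cone of objects of \<open>\<U>\<close>, and in \<open>\<W>\<^sub>m\<close> as the fiber of a morphism
  between objects of \<open>\<W>\<^sub>m\<close>.\<close>

lemma restrict_aisle_pair:
  assumes XW: "aisle_pair (obj D) \<X> \<W>'" and X: "\<U>\<^sub>m \<subseteq> \<X>" "\<X> \<subseteq> \<U>"
  shows "aisle_pair \<S> (\<S> \<inter> \<X>) (\<S> \<inter> \<W>')"
proof -
  have W': "\<W>' \<subseteq> \<W>\<^sub>m"
    using coaisleI[OF triangulated_subcat_obj UWm] aisle_pairD(4,5)[OF XW] X(1) by blast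
  have star: "A \<in> star D (\<S> \<inter> \<X>) (\<S> \<inter> \<W>')" if A: "A \<in> \<S>" for A
  proof -
    obtain X Y f g h where t: "X \<in> \<X>" "Y \<in> \<W>'" "dtri X A Y f g h"
      using aisle_pair_truncate[OF XW triangulated_subcat_objD[OF S A]] .
    obtain P C p q r where t': "P \<in> \<S> \<inter> \<U>\<^sub>m" "C \<in> \<S> \<inter> \<W>\<^sub>m" "dtri P A C p q r"
      using aisle_pair_truncate[OF SUWm A] .
    have "orth P Y" using aisle_pairD(5)[OF XW] t'(1) t(2) X(1) by blast
    then have "g \<cdot> p = hzero D P Y"
      using orthD cmp_hom[OF dtriD(2)[OF t'(3)] dtriD(3)[OF t(3)]] by blast
    then obtain a where a: "a \<in> homset D P X" "f \<cdot> a = p"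
      using dtri_lift[OF t(3) dtriD(2)[OF t'(3)]] by blast
    obtain E b c where E: "dtri P X E a b c" using dtri_cone[OF a(1)] .
    \<comment> \<open>Octahedron on \<open>P \<rightarrow> X \<rightarrow> A\<close>: its cones are \<open>E\<close>, \<open>Y\<close> and \<open>C\<close>.\<close>
    have "dtri P A C (f \<cdot> a) q r" using t'(3) a(2) by simp
    then obtain u v w where "dtri E C Y u v w" using dtri_octahedral[OF E t(3)] by metis
    then have "E \<in> \<W>\<^sub>m" using coaisle_fiber[OF triangulated_subcat_obj UWm] t'(2) t(2) W' by blast
    moreover have "E \<in> \<U>" using aisle_cone[OF triangulated_subcat_obj UW E] t'(1) t(1) X(2) Um_sub
      by blast
    ultimately have "E \<in> \<S>" using bounded_in_subcat by blast
    then have X: "X \<in> \<S>" using triangulated_subcat_extension[OF S E] t'(1) by blast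
    then have "Y \<in> \<S>" using triangulated_subcat_cone[OF S t(3) _ A] by blast
    then show ?thesis using starI[OF t(3)] X t(1,2) by blast
  qed
  show ?thesis
    unfolding aisle_pair_def
    using subcat_Int[OF subcat_triangulated[OF S]] aisle_pairD[OF XW] star
      triangulated_subcat_sho_iff[OF S] by blast
qed

text \<open>Orthogonality holds factor by factor, since \<open>\<Y> \<subseteq> \<U>\<close> and \<open>\<W>' \<subseteq> \<W>\<^sub>m\<close>. The decomposition of an arbitrary
  object comes from \<open>\<U> \<subseteq> \<U>\<^sub>m * (\<U> \<inter> \<W>\<^sub>m) \<subseteq> \<U>\<^sub>m * (\<Y> * \<W>')\<close> by rebracketing.\<close>

lemma extend_aisle_pair:
  assumes YW: "aisle_pair \<S> \<Y> \<W>'" and Y: "\<S> \<inter> \<U>\<^sub>m \<subseteq> \<Y>" "\<Y> \<subseteq> \<S> \<inter> \<U>"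
  shows "aisle_pair (obj D) (star D \<U>\<^sub>m \<Y>) (star D \<W>' \<W>)"
proof -
  have W': "\<W>' \<subseteq> \<W>\<^sub>m"
    using coaisleI[OF S SUWm] aisle_pairD(4,5)[OF YW] Y(1) by blast
  have orth: "orth A B" if AB: "A \<in> star D \<U>\<^sub>m \<Y>" "B \<in> star D \<W>' \<W>" for A B
  proof -
    obtain X Y f g h where t: "X \<in> \<U>\<^sub>m" "Y \<in> \<Y>" "dtri X A Y f g h"
      using AB(1) unfolding star_iff by blast
    obtain X' Y' f' g' h' where t': "X' \<in> \<W>'" "Y' \<in> \<W>" "dtri X' B Y' f' g' h'"
      using AB(2) unfolding star_iff by blast
    have "orth X X'" using aisle_pairD(5)[OF UWm t(1)] t'(1) W' by blast
    moreover have "orth X Y'" using aisle_pairD(5)[OF UW _ t'(2)] t(1) Um_sub by blast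
    moreover have "orth Y X'" using aisle_pairD(5)[OF YW t(2) t'(1)] .
    moreover have "orth Y Y'" using aisle_pairD(5)[OF UW _ t'(2)] t(2) assms(3) by blast
    ultimately show ?thesis
      using orth_from_middle[OF t(3)] orth_into_middle[OF t'(3)] by blast
  qed
  have "\<U> \<subseteq> star D \<U>\<^sub>m (star D \<Y> \<W>')"
  proof
    fix A assume A: "A \<in> \<U>"
    obtain P Q f g h where t: "P \<in> \<U>\<^sub>m" "Q \<in> \<W>\<^sub>m" "dtri P A Q f g h"
      using aisle_pair_truncate[OF UWm aisle_pairD(7)[OF UW A]] .
    have "Q \<in> \<U>" using aisle_cone[OF triangulated_subcat_obj UW t(3)] t(1) A Um_sub by blast
    then have "Q \<in> star D \<Y> \<W>'" using bounded_in_subcat[OF _ t(2)] YW unfolding aisle_pair_def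
      by blast
    then show "A \<in> star D \<U>\<^sub>m (star D \<Y> \<W>')" using starI[OF t(3,1)] by blast
  qed
  then have "star D \<U> \<W> \<subseteq> star D (star D (star D \<U>\<^sub>m \<Y>) \<W>') \<W>"
    using star_mono star_assoc_right by (meson subset_trans order_refl)
  then have "star D \<U> \<W> \<subseteq> star D (star D \<U>\<^sub>m \<Y>) (star D \<W>' \<W>)"
    using star_assoc_left by (meson subset_trans)
  then have star: "obj D \<subseteq> star D (star D \<U>\<^sub>m \<Y>) (star D \<W>' \<W>)"
    using UW unfolding aisle_pair_def by blast
  have shift: "sho D A \<in> star D \<U>\<^sub>m \<Y>" if A: "A \<in> star D \<U>\<^sub>m \<Y>" for A
  proof -
    obtain X Y f g h where t: "X \<in> \<U>\<^sub>m" "Y \<in> \<Y>" "dtri X A Y f g h"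
      using A unfolding star_iff by blast
    obtain f' g' h' where "dtri (sho D X) (sho D A) (sho D Y) f' g' h'" using dtri_sho[OF t(3)] .
    then show ?thesis using starI aisle_pairD(6)[OF UWm t(1)] aisle_pairD(6)[OF YW t(2)] by blast
  qed
  have "star D \<X> \<Z> \<subseteq> obj D" for \<X> \<Z> unfolding star_def by blast
  then show ?thesis unfolding aisle_pair_def using orth star shift subcat_star by blast
qed

text \<open>This identifies \<open>\<Z> * \<V>\<close> as the coaisle belonging to the aisle \<open>\<U>\<^sub>m * \<Y>\<close>. One inclusion shifts
  triangles. For the other one, \<open>\<Z>\<close> and \<open>\<V>\<close> both lie in the shift of the strict coaisle, which is
  extension-closed because it is itself a strict coaisle.\<close>

lemma level_extended_coaisle:
  assumes ap: "aisle_pair (obj D) (star D \<U>\<^sub>m \<Y>) (star D (level D \<Z> 1) \<W>)"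
    and Z: "subcat D \<Z>" and zero: "zero_object D N" "N \<in> level D \<Z> 1" "N \<in> \<W>"
  shows "level D (star D \<Z> \<V>) 1 = star D (level D \<Z> 1) \<W>" (is "_ = ?W'")
proof (intro subset_antisym subsetI)
  fix B assume "B \<in> ?W'"
  then obtain P Q f g h where t: "P \<in> level D \<Z> 1" "Q \<in> \<W>" "dtri P B Q f g h"
    unfolding star_iff by blast
  then have "sho D P \<in> \<Z>" "sho D Q \<in> \<V>" using level_1 Z subcat_V by auto
  moreover obtain f' g' h' where "dtri (sho D P) (sho D B) (sho D Q) f' g' h'"
    using dtri_sho[OF t(3)] .
  ultimately have "sho D B \<in> star D \<Z> \<V>" using starI by blast
  then show "B \<in> level D (star D \<Z> \<V>) 1"
    using level_1[OF subcat_star] dtriD(6)[OF t(3)] by blast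
next
  fix B assume "B \<in> level D (star D \<Z> \<V>) 1"
  then have B: "B \<in> obj D" "sho D B \<in> star D \<Z> \<V>" using level_1[OF subcat_star] by auto
  then obtain P Q f g h where t: "P \<in> \<Z>" "Q \<in> \<V>" "dtri P (sho D B) Q f g h"
    unfolding star_iff by blast
  have "level D \<Z> 1 \<subseteq> ?W'" using star_zero_right[OF zero(1,3)] level_obj by blast
  then have "P \<in> level D ?W' (- 1)" using level_mono level_up_down[OF Z] t(1) by blast
  moreover have "\<W> \<subseteq> ?W'" using star_zero_left[OF zero(1,2)] level_obj by blast
  then have "Q \<in> level D ?W' (- 1)" using level_mono level_up_down[OF subcat_V] t(2) by blast
  ultimately have "sho D B \<in> level D ?W' (- 1)"
    using
      coaisle_extension[OF triangulated_subcat_obj aisle_pair_shift[OF triangulated_subcat_obj ap] t(3)] by blast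
  then show "B \<in> ?W'"
    using level_down_up[OF aisle_pairD(2)[OF ap]] B(1) unfolding level_1[OF subcat_level_minus_1]
    by blast
qed

abbreviation "interval_D \<equiv> t_interval D \<U>\<^sub>m \<U>"
abbreviation "interval_S \<equiv> t_interval (full_subcat D \<S>) (\<S> \<inter> \<U>\<^sub>m) (\<S> \<inter> \<U>)"

lemma restrict_in_interval:
  assumes "(\<X>, \<Z>) \<in> interval_D"
  shows "(\<S> \<inter> \<X>, \<S> \<inter> \<Z>) \<in> interval_S"
proof -
  have Z: "subcat D \<Z>" and XW: "aisle_pair (obj D) \<X> (level D \<Z> 1)" and X: "\<U>\<^sub>m \<subseteq> \<X>" "\<X> \<subseteq> \<U>"
    using assms t_iff by (auto simp: t_interval_def)
  have Z': "subcat D (\<S> \<inter> \<Z>)" using subcat_Int[OF subcat_triangulated[OF S] Z] .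
  show ?thesis
    using restrict_aisle_pair[OF XW X] level_1_Int[OF S Z Z'] Z' X
    by (auto simp: t_interval_def t_structure_full_subcat_iff[OF S])
qed

lemma extend_in_interval:
  assumes "(\<Y>, \<Z>) \<in> interval_S"
  shows "(star D \<U>\<^sub>m \<Y>, star D \<Z> \<V>) \<in> interval_D"
proof -
  have Z: "subcat D \<Z>" and YW: "aisle_pair \<S> \<Y> (level D \<Z> 1)"
    and Y: "\<S> \<inter> \<U>\<^sub>m \<subseteq> \<Y>" "\<Y> \<subseteq> \<S> \<inter> \<U>"
    using assms by (auto simp: t_interval_def t_structure_full_subcat_iff[OF S])
  obtain N where N: "zero_object D N" using ex_zero_object by blast
  note ap = extend_aisle_pair[OF YW Y]
  have "t_structure D (star D \<U>\<^sub>m \<Y>, star D \<Z> \<V>)"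
    unfolding t_iff
    using ap subcat_star
      level_extended_coaisle[OF ap Z N zero_in_coaisle[OF S YW N] zero_in_coaisle[OF triangulated_subcat_obj UW N]] by simp
  moreover have "\<U>\<^sub>m \<subseteq> star D \<U>\<^sub>m \<Y>"
    using star_zero_right[OF N zero_in_aisle[OF S YW N]] level_obj by blast
  moreover have "star D \<U>\<^sub>m \<Y> \<subseteq> \<U>"
    unfolding star_iff subset_iff using aisle_extension[OF triangulated_subcat_obj UW] Um_sub Y(2)
    by blast
  ultimately show ?thesis by (simp add: t_interval_def)
qed

lemma restrict_extend:
  assumes YZ: "(\<Y>, \<Z>) \<in> interval_S"
  shows "(\<S> \<inter> star D \<U>\<^sub>m \<Y>, \<S> \<inter> star D \<Z> \<V>) = (\<Y>, \<Z>)"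
proof -
  have YW: "aisle_pair \<S> \<Y> (level D \<Z> 1)" and Y: "\<S> \<inter> \<U>\<^sub>m \<subseteq> \<Y>"
    using assms by (auto simp: t_interval_def t_structure_full_subcat_iff[OF S])
  obtain N where N: "zero_object D N" using ex_zero_object by blast
  have "\<S> \<inter> star D \<U>\<^sub>m \<Y> \<subseteq> \<Y>"
  proof
    fix A assume A: "A \<in> \<S> \<inter> star D \<U>\<^sub>m \<Y>"
    then have "A \<in> star D \<U>\<^sub>m \<Y>" by blast
    then obtain P Q f g h where t: "P \<in> \<U>\<^sub>m" "Q \<in> \<Y>" "dtri P A Q f g h"
      unfolding star_iff by blast
    have "P \<in> \<S>" using triangulated_subcat_fiber[OF S t(3)] A t(2) aisle_pairD(3)[OF YW] by blast
    then show "A \<in> \<Y>" using aisle_extension[OF S YW t(3)] Y t(1,2) by blast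
  qed
  moreover have "\<Y> \<subseteq> star D \<U>\<^sub>m \<Y>"
    using star_zero_left[OF N zero_in_aisle[OF triangulated_subcat_obj UWm N]] aisle_pairD(7)[OF YW]
    by blast
  ultimately have aisle: "\<S> \<inter> star D \<U>\<^sub>m \<Y> = \<Y>" using aisle_pairD(3)[OF YW] by blast
  have "t_structure (full_subcat D \<S>) (\<Y>, \<S> \<inter> star D \<Z> \<V>)"
    "t_structure (full_subcat D \<S>) (\<Y>, \<Z>)"
    using restrict_in_interval[OF extend_in_interval[OF YZ]] YZ aisle
    by (simp_all add: t_interval_def)
  then have "\<S> \<inter> star D \<Z> \<V> = \<Z>" using t_structure_aisle_eq[OF S] by blast
  then show ?thesis using aisle by simp
qed

lemma extend_restrict:
  assumes XZ: "(\<X>, \<Z>) \<in> interval_D"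
  shows "(star D \<U>\<^sub>m (\<S> \<inter> \<X>), star D (\<S> \<inter> \<Z>) \<V>) = (\<X>, \<Z>)"
proof -
  have XW: "aisle_pair (obj D) \<X> (level D \<Z> 1)" and X: "\<U>\<^sub>m \<subseteq> \<X>" "\<X> \<subseteq> \<U>"
    using assms t_iff by (auto simp: t_interval_def)
  have "star D \<U>\<^sub>m (\<S> \<inter> \<X>) \<subseteq> \<X>"
    unfolding star_iff subset_iff using aisle_extension[OF triangulated_subcat_obj XW] X(1) by blast
  moreover have "\<X> \<subseteq> star D \<U>\<^sub>m (\<S> \<inter> \<X>)"
  proof
    fix A assume A: "A \<in> \<X>"
    obtain P Q f g h where t: "P \<in> \<U>\<^sub>m" "Q \<in> \<W>\<^sub>m" "dtri P A Q f g h"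
      using aisle_pair_truncate[OF UWm aisle_pairD(7)[OF XW A]] .
    have "Q \<in> \<X>" using aisle_cone[OF triangulated_subcat_obj XW t(3)] t(1) A X(1) by blast
    then show "A \<in> star D \<U>\<^sub>m (\<S> \<inter> \<X>)" using starI[OF t(3,1)] bounded_in_subcat[OF _ t(2)] X(2)
      by blast
  qed
  ultimately have aisle: "star D \<U>\<^sub>m (\<S> \<inter> \<X>) = \<X>" by blast
  have "t_structure D (\<X>, star D (\<S> \<inter> \<Z>) \<V>)" "t_structure D (\<X>, \<Z>)"
    using extend_in_interval[OF restrict_in_interval[OF XZ]] XZ aisle
    by (simp_all add: t_interval_def)
  then have "star D (\<S> \<inter> \<Z>) \<V> = \<Z>"
    using t_structure_aisle_eq[OF triangulated_subcat_obj, unfolded full_subcat_obj] by blast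
  then show ?thesis using aisle by simp
qed

end

theorem theorem1p4:
  fixes D :: "('o, 'm, 'a) tri_cat_scheme"
    and \<U> \<V> \<S> :: "'o set"
    and m :: nat
  assumes "triangulated_category D"
    and "t_structure D (\<U>, \<V>)"
    and "m > 0"
    and "triangulated_subcat D \<S>"
    and "t_structure (full_subcat D \<S>) (\<S> \<inter> \<U>, \<S> \<inter> \<V>)"
    and "heart (\<U>, \<V>) \<subseteq> \<S>"
  shows "let P1 = t_interval D (level D \<U> (- int m)) \<U>;
             P2 = t_interval (full_subcat D \<S>) (\<S> \<inter> level D \<U> (- int m)) (\<S> \<inter> \<U>);
             lam = (\<lambda>(\<X>, \<X>'). (\<S> \<inter> \<X>, \<S> \<inter> \<X>'));
             mu = (\<lambda>(\<Y>, \<Y>'). (star D (level D \<U> (- int m)) \<Y>, star D \<Y>' \<V>))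
         in bij_betw lam P1 P2 \<and> bij_betw mu P2 P1 \<and>
            (\<forall>T \<in> P1. mu (lam T) = T) \<and> (\<forall>T \<in> P2. lam (mu T) = T) \<and>
            monotone_on P1 t_le t_le lam \<and> monotone_on P2 t_le t_le mu"
proof -
  interpret heart_in_subcat D \<U> \<V> \<S> m
    using assms by (simp add: heart_in_subcat_def heart_in_subcat_axioms_def)
  let ?lam = "\<lambda>(\<X>, \<X>'). (\<S> \<inter> \<X>, \<S> \<inter> \<X>')"
  let ?mu = "\<lambda>(\<Y>, \<Y>'). (star D \<U>\<^sub>m \<Y>, star D \<Y>' \<V>)"
  have lam: "?lam T \<in> interval_S" "?mu (?lam T) = T" if "T \<in> interval_D" for T
    using that restrict_in_interval extend_restrict by (cases T; simp)+
  have mu: "?mu T \<in> interval_D" "?lam (?mu T) = T" if "T \<in> interval_S" for T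
    using that extend_in_interval restrict_extend by (cases T; simp)+
  have "bij_betw ?lam interval_D interval_S"
    using lam mu by (intro bij_betw_byWitness[where f' = ?mu]) blast+
  moreover have "bij_betw ?mu interval_S interval_D"
    using lam mu by (intro bij_betw_byWitness[where f' = ?lam]) blast+
  moreover have "monotone_on interval_D t_le t_le ?lam"
    by (auto simp: monotone_on_def t_le_def)
  moreover have "monotone_on interval_S t_le t_le ?mu"
  proof (rule monotone_onI)
    fix T T' :: "'o set \<times> 'o set"
    assume "t_le T T'"
    then show "t_le (?mu T) (?mu T')"
      using star_mono[of "\<U>\<^sub>m" "\<U>\<^sub>m" "fst T" "fst T'"] by (simp add: t_le_def split_beta)
  qed
  ultimately show ?thesis
    unfolding Let_def using lam(2) mu(2) by blast
qed

end
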